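(* Let $k\ge a\ge 1$ be integers with $k\not\equiv a \pmod 2$. For $n\ge 0$, let $S_{k,a}(n)$ denote the number of lattice paths $L$ (in the sense described in the context) of major index $n$ that start at $(0,k+1-a)$, never go above height $k$, such that for every peak of relative height $k$ or $k-1$ the number of $E$ steps between the starting point and that peak is a multiple of $4$ (hence also the number of $E$ steps between any two such peaks is a multiple of $4$), and such that every peak with weight $x$ and relative height $r$ satisfies $x\equiv r \pmod 2$. Then \[ \sum_{n=0}^{\infty} S_{k,a}(n)q^{n}=\sum_{n_1, n_2, \ldots, n_{k-1} \geq 0}\frac{q^{N_1^2 + N_2^2 + \cdots + N_{k-1}^2 + 2N_a + 2N_{a+2} + \cdots + 2N_{k-1}}\, (-q; q^2)_{n_{k-1}}}{(q^2; q^2)_{n_1} (q^2; q^2)_{n_2} \cdots (q^2; q^2)_{n_{k-2}} (q^4; q^4)_{n_{k-1}}}, \] where $N_i=n_i+n_{i+1}+\cdots+n_{k-1}$ for $1\le i\le k-1$.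
   Context: Notation: $(a;q)_n=\prod_{j=0}^{n-1}(1-aq^j)$. Lattice paths: finite paths in the first quadrant starting on the $y$-axis and ending on the $x$-axis, each step being one of: North-East $NE$: $(x,y)\to(x+1,y+1)$; South-East $SE$: $(x,y)\to(x+1,y-1)$; East $E$: $(x,0)\to(x+1,0)$ (East steps are allowed only along the $x$-axis). Either the path has no steps, or its last step is an $SE$ step. A peak is a vertex preceded by an $NE$ step and followed by an $SE$ step. The height of a vertex $(x,y)$ is $y$ and its weight is $x$. The major index of a path is the sum of the weights of its peaks. The relative height of a peak $(x,y)$ is the largest integer $h$ for which there exist two vertices of the path $(x',y-h)$ and $(x'',y-h)$ with $x'<x<x''$ such that between these two vertices there are no peaks of height greater than $y$, and every peak of height $y$ between them has abscissa at least $x$. *)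

theory Defs
  imports
    "HOL-Analysis.Infinite_Sum"
    "HOL-Computational_Algebra.Formal_Power_Series"
    "HOL-Library.FuncSet"
begin

definition qpochhammer :: "'a::comm_ring_1 \<Rightarrow> 'a \<Rightarrow> nat \<Rightarrow> 'a" where
  "qpochhammer a q n = (\<Prod>j<n. 1 - a * q ^ j)"

datatype step = North_East | South_East | East

primrec rise :: "step \<Rightarrow> int" where
  "rise North_East = 1"
| "rise South_East = -1"
| "rise East = 0"

text \<open>
  A path is given by the ordinate \<open>s\<close> of its starting point \<open>(0, s)\<close> and the list \<open>ws\<close> of its
  steps.  Every step increases the abscissa by one, so there is exactly one vertex of each
  abscissa \<open>x \<le> length ws\<close>; we identify it with \<open>x\<close>, its weight.
\<close>

definition height :: "int \<Rightarrow> step list \<Rightarrow> nat \<Rightarrow> int" where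
  "height s ws x = s + (\<Sum>w\<leftarrow>take x ws. rise w)"

definition lattice_path :: "int \<Rightarrow> step list \<Rightarrow> bool" where
  "lattice_path s ws \<longleftrightarrow>
     (\<forall>x\<le>length ws. height s ws x \<ge> 0) \<and>
     (\<forall>x<length ws. ws ! x = East \<longrightarrow> height s ws x = 0) \<and>
     height s ws (length ws) = 0 \<and>
     (ws = [] \<or> last ws = South_East)"

definition peaks :: "step list \<Rightarrow> nat set" where
  "peaks ws = {x. 0 < x \<and> x < length ws \<and> ws ! (x - 1) = North_East \<and> ws ! x = South_East}"

definition major_index :: "step list \<Rightarrow> nat" where
  "major_index ws = (\<Sum>x\<in>peaks ws. x)"

text \<open>
  For a peak \<open>x\<close> of a lattice path the maximum exists: \<open>h = 1\<close> is admissible (take the two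
  neighbouring vertices), and \<open>h\<close> is at most the height of \<open>x\<close>.
\<close>

definition relative_height :: "int \<Rightarrow> step list \<Rightarrow> nat \<Rightarrow> int" where
  "relative_height s ws x =
     (GREATEST h. \<exists>x' x''. x' < x \<and> x < x'' \<and> x'' \<le> length ws \<and>
        height s ws x' = height s ws x - h \<and>
        height s ws x'' = height s ws x - h \<and>
        (\<forall>p\<in>peaks ws. x' < p \<and> p < x'' \<longrightarrow>
           \<not> height s ws p > height s ws x \<and>
           (height s ws p = height s ws x \<longrightarrow> p \<ge> x)))"

definition east_steps_before :: "step list \<Rightarrow> nat \<Rightarrow> nat" where
  "east_steps_before ws x = count_list (take x ws) East"

text \<open>
  The set below is finite: the last step that is not \<open>South_East\<close>, if any, is a \<open>North_East\<close>
  step leading to a peak, whose weight is at most \<open>n\<close>, and from there on the path only descends.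
\<close>

definition S_paths :: "nat \<Rightarrow> nat \<Rightarrow> nat \<Rightarrow> step list set" where
  "S_paths k a n =
     {ws. let s = int k + 1 - int a in
        lattice_path s ws \<and>
        major_index ws = n \<and>
        (\<forall>x\<le>length ws. height s ws x \<le> int k) \<and>
        (\<forall>x\<in>peaks ws. relative_height s ws x \<in> {int k, int k - 1} \<longrightarrow>
           4 dvd east_steps_before ws x) \<and>
        (\<forall>x\<in>peaks ws. int x mod 2 = relative_height s ws x mod 2)}"

definition S :: "nat \<Rightarrow> nat \<Rightarrow> nat \<Rightarrow> nat" where
  "S k a n = card (S_paths k a n)"

definition tail_sum :: "nat \<Rightarrow> (nat \<Rightarrow> nat) \<Rightarrow> nat \<Rightarrow> nat" where
  "tail_sum k n i = (\<Sum>j=i..k-1. n j)"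

end

theory Submission
  imports Defs
begin

text \<open>
  Since \<open>x + y\<close> has the parity of \<open>s\<close> plus the number of preceding East steps, the parity condition
  on a peak says that its base \<open>y - r\<close> and that number of East steps have the same parity.  By the
  elder rule the bases of the peaks are the valley heights, so the condition is local: valleys have
  even height, every maximal run of East steps is even, and after an odd number of pairs of East
  steps the ceiling \<open>k\<close> drops to \<open>k - 2\<close>.

  Sorting such paths by the number \<open>n\<close> of remaining peaks and prepending steps one at a time gives
  linear recurrences in the starting height \<open>2 j\<close>.  Writing \<open>c = q\<^bsup>2n-1\<^esup>\<close>, they combine to
  \<open>(1 + q\<^bsup>4n\<^esup>) X\<^sub>n(j) - q\<^bsup>2n\<^esup> (X\<^sub>n(j-1) + X\<^sub>n(j+1)) = c (1 + c) X\<^bsub>n-1\<^esub>(j)\<close> with boundary conditions at the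
  top that depend on the parity of \<open>k\<close>; at height \<open>0\<close> the heights available after an odd number of
  pairs act as the mirror image \<open>X\<^sub>n(-j) = X\<^sub>n(j)\<close>.  The transformation
  \<open>X\<^sub>n \<mapsto> q\<^bsup>n\<^sup>2\<^esup> (\<Sum>m\<le>n. X\<^sub>m / (q\<^sup>2; q\<^sup>2)\<^bsub>n-m\<^esub>)\<close> maps solutions for \<open>k - 1\<close> to solutions for \<open>k\<close>, and iterating
  it from \<open>k = 2\<close> produces the multisum.
\<close>

section \<open>The multisum by number of peaks\<close>

abbreviation q :: "rat fps" where "q \<equiv> fps_X"

section \<open>Convolution with \<open>1 / (q^2; q^2)_l\<close> and its effect on
  recurrences\<close>

definition inv_qfac :: "nat \<Rightarrow> rat fps" where
  "inv_qfac l = inverse (qpochhammer (q ^ 2) (q ^ 2) l)"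

definition conv :: "(nat \<Rightarrow> rat fps) \<Rightarrow> nat \<Rightarrow> rat fps" where
  "conv f n = (\<Sum>m\<le>n. inv_qfac (n - m) * f m)"

lemma qpochhammer_Suc: "qpochhammer a r (Suc n) = qpochhammer a r n * (1 - a * r ^ n)"
  by (simp add: qpochhammer_def)

lemma qpochhammer_nth_0:
  assumes "fps_nth a 0 = 0"
  shows "fps_nth (qpochhammer a r n) 0 = 1"
  using assms by (induction n) (simp_all add: qpochhammer_Suc, simp_all add: qpochhammer_def)

lemma inv_qfac_0 [simp]: "inv_qfac 0 = 1"
  by (simp add: inv_qfac_def qpochhammer_def)

lemma inv_qfac_Suc: "inv_qfac (Suc l) * (1 - q ^ (2 * Suc l)) = inv_qfac l"
proof -
  let ?a = "qpochhammer (q ^ 2) (q ^ 2) l" and ?b = "1 - q ^ (2 * Suc l)"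
  have "fps_nth ?b 0 \<noteq> 0"
    by simp
  moreover have "qpochhammer (q ^ 2) (q ^ 2) (Suc l) = ?a * ?b"
    by (simp add: qpochhammer_Suc power_add power_mult power2_eq_square)
  ultimately show ?thesis
    unfolding inv_qfac_def
    by (metis (no_types) fps_inverse_mult inverse_mult_eq_1 mult.assoc mult_1_right)
qed

lemma conv_0 [simp]: "conv f 0 = f 0"
  by (simp add: conv_def)

text \<open>The factor \<open>1 - q ^ (2 * (Suc N - m))\<close> supplied by the second hypothesis
  cancels the last factor in the denominator of \<open>inv_qfac (Suc N - m)\<close> and so lowers
  \<open>Suc N\<close> to \<open>N\<close>; the \<open>r\<close>-terms reach the same level by a
  shift of \<open>m\<close>. Since \<open>E\<close> does not depend on \<open>m\<close>, both parts
  merge into one multiple of \<open>conv f N\<close>.\<close>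

lemma conv_recurrence:
  assumes g: "\<And>m. q ^ (2 * m) * g m = A m * f m - (if m = 0 then 0 else r (m - 1) * f (m - 1))"
    and B: "\<And>m. m \<le> Suc N \<Longrightarrow> B - q ^ (2 * (Suc N - m)) * A m = (1 - q ^ (2 * (Suc N - m))) * C m"
    and E: "\<And>m. m \<le> N \<Longrightarrow> C m + q ^ (2 * (N - m)) * r m = E"
  shows "B * conv f (Suc N) - q ^ (2 * Suc N) * conv g (Suc N) = E * conv f N"
proof -
  have eq: "B * (inv_qfac (Suc N - m) * f m) - q ^ (2 * Suc N) * (inv_qfac (Suc N - m) * g m)
      = inv_qfac (Suc N - m) * (1 - q ^ (2 * (Suc N - m))) * (C m * f m)
        + inv_qfac (Suc N - m) * q ^ (2 * (Suc N - m)) * (if m = 0 then 0 else r (m - 1) * f (m - 1))"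
    if "m \<le> Suc N" for m
  proof -
    have "q ^ (2 * Suc N) = q ^ (2 * (Suc N - m)) * q ^ (2 * m)"
      using that by (simp add: power_add[symmetric] distrib_left[symmetric] del: mult_Suc_right)
    hence "B * (inv_qfac (Suc N - m) * f m) - q ^ (2 * Suc N) * (inv_qfac (Suc N - m) * g m)
      = inv_qfac (Suc N - m) * (B * f m - q ^ (2 * (Suc N - m)) * (q ^ (2 * m) * g m))"
      by (simp only:) (simp add: algebra_simps)
    also have "B * f m - q ^ (2 * (Suc N - m)) * (q ^ (2 * m) * g m)
      = (B - q ^ (2 * (Suc N - m)) * A m) * f m
         + q ^ (2 * (Suc N - m)) * (if m = 0 then 0 else r (m - 1) * f (m - 1))"
      unfolding g by (simp only: algebra_simps)
    finally show ?thesis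
      unfolding B[OF that] by (simp only: algebra_simps)
  qed
  have "B * conv f (Suc N) - q ^ (2 * Suc N) * conv g (Suc N)
     = (\<Sum>m\<le>Suc N. B * (inv_qfac (Suc N - m) * f m) - q ^ (2 * Suc N) * (inv_qfac (Suc N - m) * g m))"
    unfolding conv_def sum_distrib_left sum_subtractf ..
  also have "\<dots> = (\<Sum>m\<le>Suc N. inv_qfac (Suc N - m) * (1 - q ^ (2 * (Suc N - m))) * (C m * f m))
        + (\<Sum>m\<le>Suc N. inv_qfac (Suc N - m) * q ^ (2 * (Suc N - m)) * (if m = 0 then 0 else r (m - 1) * f (m - 1)))"
    unfolding sum.distrib[symmetric] by (rule sum.cong[OF refl]) (use eq in auto)
  \<comment> \<open>The summand \<open>m = Suc N\<close> vanishes through its factor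
    \<open>1 - q ^ 0\<close>.\<close>
  also have "(\<Sum>m\<le>Suc N. inv_qfac (Suc N - m) * (1 - q ^ (2 * (Suc N - m))) * (C m * f m))
     = (\<Sum>m\<le>N. inv_qfac (Suc N - m) * (1 - q ^ (2 * (Suc N - m))) * (C m * f m))"
    by simp
  also have "\<dots> = (\<Sum>m\<le>N. inv_qfac (N - m) * (C m * f m))"
    by (rule sum.cong[OF refl]) (use inv_qfac_Suc in \<open>auto simp: Suc_diff_le\<close>)
  also have "(\<Sum>m\<le>Suc N. inv_qfac (Suc N - m) * q ^ (2 * (Suc N - m)) * (if m = 0 then 0 else r (m - 1) * f (m - 1)))
     = (\<Sum>m\<le>N. inv_qfac (N - m) * q ^ (2 * (N - m)) * (r m * f m))"
    by (subst sum.atMost_Suc_shift) simp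
  also have "(\<Sum>m\<le>N. inv_qfac (N - m) * (C m * f m)) + \<dots> = 
    (\<Sum>m\<le>N. inv_qfac (N - m) * ((C m + q ^ (2 * (N - m)) * r m) * f m))"
    unfolding sum.distrib[symmetric] by (rule sum.cong[OF refl]) (simp add: algebra_simps)
  also have "\<dots> = E * conv f N"
    unfolding conv_def sum_distrib_left by (rule sum.cong[OF refl]) (auto simp: E)
  finally show ?thesis .
qed

text \<open>Here \<open>g\<close> stands for the sum of the two neighbours of \<open>f\<close>, and
  the first hypothesis is the recurrence at \<open>m = 0\<close>. With \<open>Suc N = m + d\<close>,
  the difference \<open>1 + q^(4m+4d) - q^(2d) (1 + q^(4m))\<close> factors as
  \<open>(1 - q^(2d)) (1 - q^(4m+2d))\<close>. The right-hand side loses a factor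
  \<open>q ^ (2 * N + 1)\<close>, which the later multiplication by \<open>q ^ n\<^sup>2\<close>
  restores.\<close>

lemma conv_interior:
  assumes 0: "g 0 = 2 * f 0"
    and Suc: "\<And>m. (1 + q ^ (4 * Suc m)) * f (Suc m) - q ^ (2 * Suc m) * g (Suc m)
               = q ^ (2 * m + 1) * (1 + q ^ (2 * m + 1)) * f m"
  shows "(1 + q ^ (4 * Suc N)) * conv f (Suc N) - q ^ (2 * Suc N) * conv g (Suc N)
           = (1 + q ^ (2 * N + 1)) * conv f N"
proof (rule conv_recurrence)
  fix m
  show "q ^ (2 * m) * g m = (1 + q ^ (4 * m)) * f m
      - (if m = 0 then 0 else q ^ (2 * (m - 1) + 1) * (1 + q ^ (2 * (m - 1) + 1)) * f (m - 1))"
  proof (cases m)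
    case (Suc l)
    show ?thesis
      using assms(2)[of l] unfolding \<open>m = Suc l\<close> by (simp add: algebra_simps)
  qed (simp add: 0)
next
  fix m assume "m \<le> Suc N"
  then obtain d where d: "Suc N = m + d"
    using le_iff_add by blast
  show "(1 + q ^ (4 * Suc N)) - q ^ (2 * (Suc N - m)) * (1 + q ^ (4 * m))
      = (1 - q ^ (2 * (Suc N - m))) * (1 - q ^ (2 * (Suc N + m)))"
    unfolding d by (simp add: algebra_simps flip: power_add)
next
  fix m assume "m \<le> N"
  then obtain d where d: "N = m + d"
    using le_iff_add by blast
  show "(1 - q ^ (2 * (Suc N + m))) + q ^ (2 * (N - m)) * (q ^ (2 * m + 1) * (1 + q ^ (2 * m + 1)))
      = 1 + q ^ (2 * N + 1)"
    unfolding d by (simp add: algebra_simps flip: power_add power_Suc power_Suc2)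
qed

text \<open>The top condition for odd \<open>k\<close> acquires the right-hand side of
  \<open>conv_interior\<close>, as the next, even \<open>k\<close> needs.\<close>

lemma conv_top_odd:
  assumes 0: "g 0 = f 0"
    and Suc: "\<And>m. f (Suc m) - q ^ (2 * Suc m) * g (Suc m) = q ^ (2 * m + 1) * f m"
  shows "conv f (Suc N) - q ^ (2 * Suc N) * conv g (Suc N) = (1 + q ^ (2 * N + 1)) * conv f N"
proof -
  have "1 * conv f (Suc N) - q ^ (2 * Suc N) * conv g (Suc N) = (1 + q ^ (2 * N + 1)) * conv f N"
  proof (rule conv_recurrence)
    fix m
    show "q ^ (2 * m) * g m = 1 * f m - (if m = 0 then 0 else q ^ (2 * (m - 1) + 1) * f (m - 1))"
      using 0 assms(2)[of "m - 1"] by (cases m) (simp_all add: algebra_simps)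
  next
    fix m assume "m \<le> Suc N"
    show "1 - q ^ (2 * (Suc N - m)) * 1 = (1 - q ^ (2 * (Suc N - m))) * 1"
      by simp
  next
    fix m assume "m \<le> N"
    then obtain d where d: "N = m + d"
      using le_iff_add by blast
    show "1 + q ^ (2 * (N - m)) * q ^ (2 * m + 1) = 1 + q ^ (2 * N + 1)"
      unfolding d by (simp add: algebra_simps flip: power_add power_Suc power_Suc2)
  qed
  thus ?thesis by simp
qed

text \<open>The top condition for even \<open>k\<close> turns into the one for the next, odd
  \<open>k\<close>, up to the factor \<open>q ^ n\<^sup>2\<close>.\<close>

lemma conv_top_even:
  assumes "\<And>m. f m = q ^ (2 * m) * g m"
  shows "conv f (Suc N) - q ^ (2 * Suc N) * conv g (Suc N) = conv f N"
proof -
  have "1 * conv f (Suc N) - q ^ (2 * Suc N) * conv g (Suc N) = 1 * conv f N"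
    by (rule conv_recurrence[where A = "\<lambda>_. 1" and C = "\<lambda>_. 1" and r = "\<lambda>_. 0"]) (simp_all add: assms)
  thus ?thesis by simp
qed

lemma conv_add: "conv (\<lambda>m. f m + g m) n = conv f n + conv g n"
  by (simp add: conv_def algebra_simps sum.distrib)

section \<open>The functions \<open>peak_gf\<close> and their three-term recurrence\<close>

primrec peak_gf :: "nat \<Rightarrow> nat \<Rightarrow> nat \<Rightarrow> rat fps" where
  "peak_gf 0 = (\<lambda>j n. q ^ (n\<^sup>2 + 2 * n * j) * qpochhammer (- q) (q ^ 2) n
                  * inverse (qpochhammer (q ^ 4) (q ^ 4) n))"
| "peak_gf (Suc t) = (\<lambda>j n. if 2 * j \<le> t + 2 then q ^ n\<^sup>2 * conv (peak_gf t j) n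
                  else q ^ (n\<^sup>2 + 2 * n) * conv (peak_gf t (j - 1)) n)"

text \<open>
  \<open>peak_gf t j n\<close> is the part of the sum for \<open>k = t + 2\<close> and starting height \<open>2 j\<close> with
  \<open>N\<^sub>1 = n\<close>.  As a function of \<open>j\<close> it satisfies a three-term recurrence whose even extension to
  negative \<open>j\<close> makes \<open>1\<close> the neighbour of \<open>0\<close> on both sides.
\<close>

definition below :: "nat \<Rightarrow> nat" where
  "below j = (if j = 0 then 1 else j - 1)"

lemma peak_gf_no_peak: "peak_gf t j 0 = 1"
  by (induction t arbitrary: j) (simp_all add: qpochhammer_def)

lemma power_Suc_square: "q ^ (Suc n)\<^sup>2 = q ^ n\<^sup>2 * q ^ (2 * n + 1)"
proof -
  have "(Suc n)\<^sup>2 = n\<^sup>2 + (2 * n + 1)"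
    by (simp add: power2_eq_square)
  thus ?thesis by (simp only: power_add)
qed

lemma peak_gf_base_Suc:
  "(1 - q ^ (4 * Suc n)) * peak_gf 0 0 (Suc n) = q ^ (2 * n + 1) * (1 + q ^ (2 * n + 1)) * peak_gf 0 0 n"
proof -
  let ?b = "1 - q ^ (4 * Suc n)"
  have b: "?b * inverse ?b = 1"
    by (rule inverse_mult_eq_1') simp
  have Suc1: "qpochhammer (q ^ 4) (q ^ 4) (Suc n) = qpochhammer (q ^ 4) (q ^ 4) n * ?b"
    by (simp add: qpochhammer_Suc power_add power_mult)
  have Suc2: "qpochhammer (- q) (q ^ 2) (Suc n) = qpochhammer (- q) (q ^ 2) n * (1 + q ^ (2 * n + 1))"
    by (simp add: qpochhammer_Suc power_mult)
  have "?b * peak_gf 0 0 (Suc n) = (?b * inverse ?b) * (q ^ (Suc n)\<^sup>2 * (qpochhammer (- q) (q ^ 2) n * (1 + q ^ (2 * n + 1)))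
          * inverse (qpochhammer (q ^ 4) (q ^ 4) n))"
    by (simp only: peak_gf.simps Suc1 Suc2 fps_inverse_mult mult_0_right mult_0 add_0_right add_0_left ac_simps)
  also have "\<dots> = q ^ (2 * n + 1) * (1 + q ^ (2 * n + 1)) * peak_gf 0 0 n"
    unfolding b power_Suc_square by (simp only: peak_gf.simps mult_0_right mult_0 add_0_right add_0_left ac_simps mult_1_left)
  finally show ?thesis .
qed

text \<open>The second branch of \<open>peak_gf\<close>, and the exponent \<open>2 * n * j\<close>
  in the base case, encode exactly this. On paths: from height \<open>k\<close> two South-East steps
  are forced, and each moves all \<open>n\<close> peaks by one.\<close>

lemma peak_gf_top_even:
  assumes "t + 2 = 2 * m"
  shows "peak_gf t m n = q ^ (2 * n) * peak_gf t (m - 1) n"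
proof (cases t)
  case 0
  thus ?thesis using assms by (simp add: power_add ac_simps)
next
  case (Suc u)
  thus ?thesis using assms by (auto simp: power_add ac_simps)
qed

text \<open>The two relations feed each other, hence the joint induction: the odd top of
  \<open>t\<close> yields the highest interior point of \<open>Suc t\<close>, and the even top of
  \<open>t\<close> yields the odd top of \<open>Suc t\<close>.\<close>

lemma peak_gf_interior_odd:
  "(2 * j + 2 \<le> t + 2 \<longrightarrow>
      (1 + q ^ (4 * Suc n)) * peak_gf t j (Suc n)
         - q ^ (2 * Suc n) * (peak_gf t (below j) (Suc n) + peak_gf t (j + 1) (Suc n))
       = q ^ (2 * n + 1) * (1 + q ^ (2 * n + 1)) * peak_gf t j n) \<and>
   (t + 2 = 2 * j + 1 \<longrightarrow>
      peak_gf t j (Suc n) - q ^ (2 * Suc n) * peak_gf t (j - 1) (Suc n) = q ^ (2 * n + 1) * peak_gf t j n)"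
proof (induction t arbitrary: j n)
  case 0
  have eq: "peak_gf 0 (Suc 0) (Suc n) = q ^ (2 * Suc n) * peak_gf 0 0 (Suc n)"
    using peak_gf_top_even[of 0 1 "Suc n"] by simp
  have eq2: "q ^ (4 * Suc n) = q ^ (2 * Suc n) * q ^ (2 * Suc n)"
    by (simp only: power_add[symmetric], rule arg_cong[where f = "(^) q"]) simp
  show ?case
  proof (intro conjI impI)
    assume "2 * j + 2 \<le> 0 + 2"
    hence [simp]: "j = 0" by simp
    \<comment> \<open>Both neighbours of \<open>0\<close> are \<open>1\<close>, whose value is
      \<open>Q = q ^ (2 * Suc n)\<close> times that at \<open>0\<close>; so
      \<open>1 + Q^2 - 2 Q^2 = 1 - Q^2\<close>, the factor relating consecutive base terms.\<close>
    have "(1 + q ^ (4 * Suc n)) * peak_gf 0 0 (Suc n) - q ^ (2 * Suc n) * (peak_gf 0 1 (Suc n) + peak_gf 0 1 (Suc n))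
      = (1 - q ^ (4 * Suc n)) * peak_gf 0 0 (Suc n)"
      unfolding One_nat_def eq eq2 by (simp only: algebra_simps)
    thus "(1 + q ^ (4 * Suc n)) * peak_gf 0 j (Suc n)
         - q ^ (2 * Suc n) * (peak_gf 0 (below j) (Suc n) + peak_gf 0 (j + 1) (Suc n))
       = q ^ (2 * n + 1) * (1 + q ^ (2 * n + 1)) * peak_gf 0 j n"
      unfolding peak_gf_base_Suc by (simp only: below_def \<open>j = 0\<close> simp_thms if_True add_0_left)
  next
    assume "0 + 2 = 2 * j + 1"
    hence False by presburger
    thus "peak_gf 0 j (Suc n) - q ^ (2 * Suc n) * peak_gf 0 (j - 1) (Suc n) = q ^ (2 * n + 1) * peak_gf 0 j n" ..
  qed
next
  case (Suc t)
  have low: "peak_gf (Suc t) i l = q ^ l\<^sup>2 * conv (peak_gf t i) l" if "2 * i \<le> t + 2" for i l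
    using that by simp
  show ?case
  proof (intro conjI impI)
    assume j: "2 * j + 2 \<le> Suc t + 2"
    have jt: "2 * j \<le> t + 2"
      using j by simp
    have below: "2 * below j \<le> t + 2"
      using j by (auto simp: below_def)
    show "(1 + q ^ (4 * Suc n)) * peak_gf (Suc t) j (Suc n)
         - q ^ (2 * Suc n) * (peak_gf (Suc t) (below j) (Suc n) + peak_gf (Suc t) (j + 1) (Suc n))
       = q ^ (2 * n + 1) * (1 + q ^ (2 * n + 1)) * peak_gf (Suc t) j n"
    proof (cases "2 * j + 2 \<le> t + 2")
      case True
      let ?g = "\<lambda>l. peak_gf t (below j) l + peak_gf t (j + 1) l"
      have *: "(1 + q ^ (4 * Suc n)) * conv (peak_gf t j) (Suc n) - q ^ (2 * Suc n) * conv ?g (Suc n)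
           = (1 + q ^ (2 * n + 1)) * conv (peak_gf t j) n"
        by (rule conv_interior) (use Suc.IH True in \<open>auto simp: peak_gf_no_peak\<close>)
      have "(1 + q ^ (4 * Suc n)) * peak_gf (Suc t) j (Suc n)
         - q ^ (2 * Suc n) * (peak_gf (Suc t) (below j) (Suc n) + peak_gf (Suc t) (j + 1) (Suc n))
        = q ^ (Suc n)\<^sup>2 * ((1 + q ^ (4 * Suc n)) * conv (peak_gf t j) (Suc n) - q ^ (2 * Suc n) * conv ?g (Suc n))"
        unfolding conv_add using True below by (subst (1 2 3) low) (simp_all add: algebra_simps)
      also have "\<dots> = q ^ (2 * n + 1) * (1 + q ^ (2 * n + 1)) * peak_gf (Suc t) j n"
        unfolding * power_Suc_square low[OF jt] by (simp only: ac_simps)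
      finally show ?thesis .
    next
      case False
      hence t: "t + 2 = 2 * j + 1" using j by simp
      hence j0: "below j = j - 1" "j > 0" by (auto simp: below_def)
      have *: "conv (peak_gf t j) (Suc n) - q ^ (2 * Suc n) * conv (peak_gf t (j - 1)) (Suc n)
          = (1 + q ^ (2 * n + 1)) * conv (peak_gf t j) n"
        by (rule conv_top_odd) (use Suc.IH t in \<open>auto simp: peak_gf_no_peak\<close>)
      \<comment> \<open>As \<open>j + 1\<close> is the even top for \<open>Suc t\<close>, its term
        cancels the one with \<open>q ^ (4 * Suc n)\<close>, leaving the difference treated by
        \<open>conv_top_odd\<close>.\<close>
      have "peak_gf (Suc t) (j + 1) (Suc n) = q ^ (2 * Suc n) * peak_gf (Suc t) j (Suc n)"
        by (subst peak_gf_top_even) (use t in auto)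
      moreover have "q ^ (4 * Suc n) = q ^ (2 * Suc n) * q ^ (2 * Suc n)"
        by (simp only: power_add[symmetric], rule arg_cong[where f = "(^) q"]) simp
      ultimately have "(1 + q ^ (4 * Suc n)) * peak_gf (Suc t) j (Suc n)
         - q ^ (2 * Suc n) * (peak_gf (Suc t) (below j) (Suc n) + peak_gf (Suc t) (j + 1) (Suc n))
        = peak_gf (Suc t) j (Suc n) - q ^ (2 * Suc n) * peak_gf (Suc t) (j - 1) (Suc n)"
        unfolding j0 by (simp only: algebra_simps mult_1_left)
      also have "\<dots> = q ^ (Suc n)\<^sup>2 * (conv (peak_gf t j) (Suc n) - q ^ (2 * Suc n) * conv (peak_gf t (j - 1)) (Suc n))"
        using t by (subst (1 2) low) (simp_all add: algebra_simps)
      also have "\<dots> = q ^ (2 * n + 1) * (1 + q ^ (2 * n + 1)) * peak_gf (Suc t) j n"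
        unfolding * power_Suc_square low[OF jt] by (simp only: ac_simps)
      finally show ?thesis .
    qed
  next
    assume j: "Suc t + 2 = 2 * j + 1"
    hence jt: "2 * j \<le> t + 2" by simp
    have *: "conv (peak_gf t j) (Suc n) - q ^ (2 * Suc n) * conv (peak_gf t (j - 1)) (Suc n)
          = conv (peak_gf t j) n"
      by (rule conv_top_even, rule peak_gf_top_even) (use j in auto)
    have "peak_gf (Suc t) j (Suc n) - q ^ (2 * Suc n) * peak_gf (Suc t) (j - 1) (Suc n)
        = q ^ (Suc n)\<^sup>2 * (conv (peak_gf t j) (Suc n) - q ^ (2 * Suc n) * conv (peak_gf t (j - 1)) (Suc n))"
      using j by (subst (1 2) low) (simp_all add: algebra_simps)
    also have "\<dots> = q ^ (2 * n + 1) * peak_gf (Suc t) j n"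
      unfolding * power_Suc_square low[OF jt] by (simp only: ac_simps)
    finally show "peak_gf (Suc t) j (Suc n) - q ^ (2 * Suc n) * peak_gf (Suc t) (j - 1) (Suc n)
       = q ^ (2 * n + 1) * peak_gf (Suc t) j n" .
  qed
qed

section \<open>Paths as words of an automaton\<close>

text \<open>The highest peak between two ground points has relative height equal to its height, so
  forbidding relative heights \<open>k\<close> and \<open>k - 1\<close> there amounts to a ceiling
  of \<open>k - 2\<close>.\<close>

definition ceiling_at :: "nat \<Rightarrow> nat \<Rightarrow> int" where
  "ceiling_at k e = (if 4 dvd e then int k else int k - 2)"

text \<open>
  The state consists of the number \<open>e\<close> of East steps made so far, the previous step \<open>p\<close> and the
  current height \<open>y\<close>.  The start of a path counts as preceded by a South-East step, so that the
  empty path may be accepted and a path may begin as if it left a valley.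
\<close>

primrec accepts :: "nat \<Rightarrow> nat \<Rightarrow> step \<Rightarrow> int \<Rightarrow> step list \<Rightarrow> bool" where
  "accepts k e p y [] \<longleftrightarrow> y = 0 \<and> p = South_East"
| "accepts k e p y (w # ws) \<longleftrightarrow> (case w of
      North_East \<Rightarrow> even e \<and> (p = North_East \<or> even y) \<and> y + 1 \<le> ceiling_at k e
                    \<and> accepts k e North_East (y + 1) ws
    | South_East \<Rightarrow> y > 0 \<and> accepts k e South_East (y - 1) ws
    | East \<Rightarrow> y = 0 \<and> accepts k (Suc e) East 0 ws)"

text \<open>
  Peak weights are measured from the current vertex, so prepending a step to a path with \<open>n\<close>
  later peaks adds \<open>n\<close> to \<open>major\<close>.
\<close>

primrec npeaks :: "step \<Rightarrow> step list \<Rightarrow> nat" where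
  "npeaks p [] = 0"
| "npeaks p (w # ws) = (if p = North_East \<and> w = South_East then 1 else 0) + npeaks w ws"

primrec major :: "step list \<Rightarrow> nat" where
  "major [] = 0"
| "major (w # ws) = npeaks w ws + major ws"

definition words :: "nat \<Rightarrow> nat \<Rightarrow> step \<Rightarrow> int \<Rightarrow> nat \<Rightarrow> nat \<Rightarrow> step list set" where
  "words k e p y n m = {ws. accepts k e p y ws \<and> npeaks p ws = n \<and> major ws = m}"

definition word_gf :: "nat \<Rightarrow> nat \<Rightarrow> step \<Rightarrow> int \<Rightarrow> nat \<Rightarrow> rat fps" where
  "word_gf k e p y n = Abs_fps (\<lambda>m. of_nat (card (words k e p y n m)))"

lemma ceiling_at_add_4 [simp]: "ceiling_at k (e + 4) = ceiling_at k e"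
  by (simp add: ceiling_at_def)

lemma accepts_add_4: "accepts k (e + 4) p y ws = accepts k e p y ws"
proof (induction ws arbitrary: e p y)
  case (Cons w ws)
  have "accepts k (Suc (e + 4)) p y ws = accepts k (Suc e) p y ws" for p y
    using Cons.IH[of "Suc e"] by simp
  thus ?case by (cases w) (simp_all only: accepts.simps Cons.IH ceiling_at_add_4 step.case even_add, simp_all)
qed simp

lemma word_gf_add_4: "word_gf k (e + 4) p y n = word_gf k e p y n"
  by (simp add: word_gf_def words_def accepts_add_4)

text \<open>A North-East step must eventually be followed by a descent, which creates a peak; an
  East step with only a descent from height \<open>0\<close> after it would be the last step, which
  has to be South-East.\<close>

lemma accepts_no_peak:
  assumes "accepts k e p y ws" "npeaks p ws = 0" "y \<ge> 0"
  shows "p \<noteq> North_East \<and> ws = replicate (nat y) South_East"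
  using assms
proof (induction ws arbitrary: e p y)
  case (Cons w ws)
  show ?case
  proof (cases w)
    case North_East
    thus ?thesis using Cons.IH[of e North_East "y + 1"] Cons.prems by simp
  next
    case South_East
    have "nat y = Suc (nat (y - 1))"
      using Cons.prems(1) South_East by auto
    thus ?thesis using Cons.IH[of e South_East "y - 1"] Cons.prems South_East
      by (auto split: if_splits)
  next
    case East
    have "ws = []" using Cons.IH[of "Suc e" East 0] Cons.prems East by simp
    thus ?thesis using Cons.prems East by simp
  qed
qed auto

lemma accepts_descent: "accepts k e South_East (int l) (replicate l South_East)"
  by (induction l) auto

lemma npeaks_descent: "npeaks South_East (replicate l South_East) = 0"
  by (induction l) auto

lemma major_descent: "major (replicate l South_East) = 0"
  by (induction l) (auto simp: npeaks_descent)

lemma words_no_peak: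
  "words k e South_East (int l) 0 m = (if m = 0 then {replicate l South_East} else {})"
proof -
  have "accepts k e South_East (int l) ws \<and> npeaks South_East ws = 0 \<longleftrightarrow> ws = replicate l South_East" (is "?A \<longleftrightarrow> ?B") for ws
  proof
    assume ?A
    thus ?B using accepts_no_peak[of k e South_East "int l" ws] by simp
  next
    assume ?B
    thus ?A by (simp add: accepts_descent npeaks_descent)
  qed
  hence "words k e South_East (int l) 0 m = {ws. ws = replicate l South_East \<and> major ws = m}"
    by (simp only: words_def conj_assoc[symmetric])
  moreover have "ws = replicate l South_East \<and> major ws = m \<longleftrightarrow> ws = replicate l South_East \<and> m = 0" for ws
    using major_descent[of l] by metis
  ultimately show ?thesis by simp
qed

lemma word_gf_no_peak: "word_gf k e South_East (int l) 0 = 1"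
  by (rule fps_ext) (simp add: word_gf_def words_no_peak)

text \<open>Each step with a later peak still ahead adds at least 1 to \<open>major\<close>. Behind
  the last such step come one more step and a pure descent of length at most
  \<open>k\<close>.\<close>

lemma accepts_length:
  assumes "accepts k e p y ws" "0 \<le> y" "y \<le> int k"
  shows "length ws \<le> major ws + k + 1"
  using assms
proof (induction ws arbitrary: e p y)
  case (Cons w ws)
  obtain e' y' where *: "accepts k e' w y' ws" "0 \<le> y'" "y' \<le> int k"
    using Cons.prems by (cases w) (auto simp: ceiling_at_def split: if_splits)
  show ?case
  proof (cases "npeaks w ws = 0")
    case True
    have "length ws = nat y'" using accepts_no_peak[OF *(1) True *(2)] by simp
    thus ?thesis using * by simp
  next
    case False
    thus ?thesis using Cons.IH[OF *] by simp
  qed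
qed simp

lemma finite_words:
  assumes "0 \<le> y" "y \<le> int k"
  shows "finite (words k e p y n m)"
proof (rule finite_subset)
  show "words k e p y n m \<subseteq> {ws. set ws \<subseteq> {North_East, South_East, East} \<and> length ws \<le> m + k + 1}"
  proof
    fix ws assume "ws \<in> words k e p y n m"
    hence "length ws \<le> m + k + 1"
      using accepts_length[OF _ assms] by (auto simp: words_def)
    moreover have "set ws \<subseteq> {North_East, South_East, East}"
      using step.exhaust by blast
    ultimately show "ws \<in> {ws. set ws \<subseteq> {North_East, South_East, East} \<and> length ws \<le> m + k + 1}"
      by simp
  qed
qed (rule finite_lists_length_le, simp)

section \<open>Recurrences from the first step of a word\<close>

lemma words_Suc:
  fixes p :: step
  assumes n: "n > 0"
  defines "n' \<equiv> (if p = North_East then n - 1 else n)"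
  shows "words k e p y n m =
      (if even e \<and> (p = North_East \<or> even y) \<and> y + 1 \<le> ceiling_at k e \<and> n \<le> m
         then (#) North_East ` words k e North_East (y + 1) n (m - n) else {})
    \<union> ((if y > 0 \<and> n' \<le> m then (#) South_East ` words k e South_East (y - 1) n' (m - n') else {})
    \<union> (if y = 0 \<and> n \<le> m then (#) East ` words k (Suc e) East 0 n (m - n) else {}))"
    (is "_ = ?N \<union> (?S \<union> ?E)")
proof (rule set_eqI)
  fix ws
  show "ws \<in> words k e p y n m \<longleftrightarrow> ws \<in> ?N \<union> (?S \<union> ?E)"
  proof (cases ws)
    case Nil
    thus ?thesis using n by (auto simp: words_def)
  next
    case (Cons w vs)
    show ?thesis using n unfolding Cons n'_def
      by (cases w) (auto simp: words_def image_iff)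
  qed
qed

lemma nth_if_word_gf:
  "fps_nth (if b then q ^ l * word_gf k e p y n else 0) m
     = of_nat (if b \<and> l \<le> m then card (words k e p y n (m - l)) else 0)"
  by (simp add: fps_X_power_mult_nth word_gf_def)

text \<open>A step moves the origin of the weights, so it costs \<open>q\<close> to the number of
  peaks still ahead. That number is \<open>n\<close>, except that a South-East step after a
  North-East step completes a peak of weight \<open>0\<close> at the current vertex and leaves
  \<open>n - 1\<close>.\<close>

lemma word_gf_Suc:
  fixes p :: step
  assumes n: "n > 0" and y: "0 \<le> y" "y \<le> int k"
  defines "n' \<equiv> (if p = North_East then n - 1 else n)"
  shows "word_gf k e p y n =
      (if even e \<and> (p = North_East \<or> even y) \<and> y + 1 \<le> ceiling_at k e
         then q ^ n * word_gf k e North_East (y + 1) n else 0)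
    + ((if y > 0 then q ^ n' * word_gf k e South_East (y - 1) n' else 0)
    + (if y = 0 then q ^ n * word_gf k (Suc e) East 0 n else 0))"
proof (rule fps_ext)
  fix m
  let ?N = "if even e \<and> (p = North_East \<or> even y) \<and> y + 1 \<le> ceiling_at k e \<and> n \<le> m
         then (#) North_East ` words k e North_East (y + 1) n (m - n) else {}"
  let ?S = "if y > 0 \<and> n' \<le> m then (#) South_East ` words k e South_East (y - 1) n' (m - n') else {}"
  let ?E = "if y = 0 \<and> n \<le> m then (#) East ` words k (Suc e) East 0 n (m - n) else {}"
  have fin: "finite ?N" "finite ?S" "finite ?E"
    using y finite_words by (auto simp: ceiling_at_def split: if_splits)
  have "card (words k e p y n m) = card ?N + (card ?S + card ?E)"
    unfolding words_Suc[OF n, of k e p y m] n'_def[symmetric] using fin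
    by (subst card_Un_disjoint, simp, simp, force, subst card_Un_disjoint) auto
  moreover have "card ?N = (if even e \<and> (p = North_East \<or> even y) \<and> y + 1 \<le> ceiling_at k e \<and> n \<le> m
         then card (words k e North_East (y + 1) n (m - n)) else 0)"
    by (auto simp: card_image)
  moreover have "card ?S = (if y > 0 \<and> n' \<le> m then card (words k e South_East (y - 1) n' (m - n')) else 0)"
    by (simp add: card_image)
  moreover have "card ?E = (if y = 0 \<and> n \<le> m then card (words k (Suc e) East 0 n (m - n)) else 0)"
    by (simp add: card_image)
  ultimately have "card (words k e p y n m) =
      (if even e \<and> (p = North_East \<or> even y) \<and> y + 1 \<le> ceiling_at k e \<and> n \<le> m
         then card (words k e North_East (y + 1) n (m - n)) else 0)
    + ((if y > 0 \<and> n' \<le> m then card (words k e South_East (y - 1) n' (m - n')) else 0)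
    + (if y = 0 \<and> n \<le> m then card (words k (Suc e) East 0 n (m - n)) else 0))"
    by (simp only:)
  moreover have "fps_nth (word_gf k e p y n) m = of_nat (card (words k e p y n m))"
    by (simp add: word_gf_def)
  ultimately show "fps_nth (word_gf k e p y n) m = fps_nth ((if even e \<and> (p = North_East \<or> even y) \<and> y + 1 \<le> ceiling_at k e
         then q ^ n * word_gf k e North_East (y + 1) n else 0)
    + ((if y > 0 then q ^ n' * word_gf k e South_East (y - 1) n' else 0)
    + (if y = 0 then q ^ n * word_gf k (Suc e) East 0 n else 0))) m"
    by (simp only: fps_add_nth of_nat_add nth_if_word_gf conj_assoc)
qed

text \<open>At height \<open>0\<close> the two previous steps are distinguished only by acceptance
  of the empty word, which has no peak.\<close>

lemma words_East_eq:
  assumes "n > 0"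
  shows "words k e East 0 n m = words k e South_East 0 n m"
proof (rule set_eqI)
  fix ws
  show "ws \<in> words k e East 0 n m \<longleftrightarrow> ws \<in> words k e South_East 0 n m"
    using assms by (cases ws) (auto simp: words_def split: step.split)
qed

lemma word_gf_East_eq:
  assumes "n > 0"
  shows "word_gf k e East 0 n = word_gf k e South_East 0 n"
  by (simp only: word_gf_def words_East_eq[OF assms])

lemma word_gf_odd_ground:
  assumes "n > 0" "odd e"
  shows "word_gf k e South_East 0 n = q ^ n * word_gf k (Suc e) South_East 0 n"
  using assms by (subst word_gf_Suc) (auto simp: word_gf_East_eq)

text \<open>For even \<open>e\<close>, this is the contribution to
  \<open>word_gf k e South_East (2 * int j) n\<close> of words that begin with a North-East
  step.\<close>

definition upper_gf :: "nat \<Rightarrow> nat \<Rightarrow> nat \<Rightarrow> nat \<Rightarrow> rat fps" where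
  "upper_gf k e j n = (if 2 * int j + 1 \<le> ceiling_at k e
     then q ^ n * word_gf k e North_East (2 * int j + 1) n else 0)"

lemma ceiling_at_le: "ceiling_at k e \<le> int k"
  by (simp add: ceiling_at_def)

text \<open>After an East step the East count is odd, so a second East step is forced; the pair
  costs \<open>q ^ (2 * n)\<close>.\<close>

lemma word_gf_ground:
  assumes "n > 0" "even e"
  shows "word_gf k e South_East 0 n = upper_gf k e 0 n + q ^ (2 * n) * word_gf k (e + 2) South_East 0 n"
proof -
  have "word_gf k e South_East 0 n = upper_gf k e 0 n + q ^ n * word_gf k (Suc e) South_East 0 n"
    using assms by (subst word_gf_Suc) (auto simp: word_gf_East_eq upper_gf_def)
  moreover have "word_gf k (Suc e) South_East 0 n = q ^ n * word_gf k (e + 2) South_East 0 n"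
    using assms by (subst word_gf_odd_ground) auto
  ultimately show ?thesis
    by (simp only: mult_2 power_add mult.assoc)
qed

text \<open>At an odd height after a South-East step, the evenness of valleys excludes North-East
  and positive height excludes East.\<close>

lemma word_gf_descend_odd:
  assumes "2 * int j + 1 \<le> int k"
  shows "word_gf k e South_East (2 * int j + 1) n = q ^ n * word_gf k e South_East (2 * int j) n"
proof (cases "n = 0")
  case True
  thus ?thesis
    using word_gf_no_peak[of k e "2 * j + 1"] word_gf_no_peak[of k e "2 * j"] by (simp add: add.commute)
next
  case False
  thus ?thesis using assms by (subst word_gf_Suc) auto
qed

lemma word_gf_descend_even:
  assumes "n > 0" "even e" "2 * int j + 2 \<le> int k"
  shows "word_gf k e South_East (2 * int (Suc j)) n
     = upper_gf k e (Suc j) n + q ^ (2 * n) * word_gf k e South_East (2 * int j) n"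
proof -
  have "word_gf k e South_East (2 * int (Suc j)) n
     = upper_gf k e (Suc j) n + q ^ n * word_gf k e South_East (2 * int j + 1) n"
    using assms by (subst word_gf_Suc) (auto simp: upper_gf_def algebra_simps)
  moreover have "word_gf k e South_East (2 * int j + 1) n = q ^ n * word_gf k e South_East (2 * int j) n"
    using assms by (intro word_gf_descend_odd) simp
  ultimately show ?thesis
    by (simp only: mult_2 power_add mult.assoc)
qed

lemma upper_gf_above: "2 * int j + 1 > ceiling_at k e \<Longrightarrow> upper_gf k e j n = 0"
  by (simp add: upper_gf_def)

lemma word_gf_ascend:
  assumes "even e" "0 < y" "y \<le> ceiling_at k e"
  shows "word_gf k e North_East y (Suc n) =
    (if y + 1 \<le> ceiling_at k e then q ^ Suc n * word_gf k e North_East (y + 1) (Suc n) else 0)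
      + q ^ n * word_gf k e South_East (y - 1) n"
  using word_gf_Suc[where n = "Suc n" and y = y and k = k and p = North_East and e = e] assms ceiling_at_le[of k e] by simp

lemma upper_gf_top:
  assumes "even e" "2 * int j + 1 = ceiling_at k e"
  shows "upper_gf k e j (Suc n) = q ^ (2 * n + 1) * word_gf k e South_East (2 * int j) n"
proof -
  have "word_gf k e North_East (2 * int j + 1) (Suc n) = q ^ n * word_gf k e South_East (2 * int j) n"
    using word_gf_ascend[of e "2 * int j + 1" k n] assms(1) unfolding assms(2)[symmetric] by simp
  moreover have "q ^ (2 * n + 1) = q ^ Suc n * q ^ n"
    by (simp add: mult_2 power_add)
  ultimately show ?thesis
    using assms(2) by (simp only: upper_gf_def order_refl if_True mult.assoc)
qed

text \<open>Three continuations of the ascent from \<open>2 * j\<close>: a peak at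
  \<open>2 * j + 1\<close>, a peak at \<open>2 * j + 2\<close> followed by a forced second descent,
  or a climb beyond \<open>2 * j + 2\<close>. The first two return to height \<open>2 * j\<close>
  with one peak fewer, at costs \<open>q ^ (2 * n + 1)\<close> and its square.\<close>

lemma upper_gf_step:
  assumes "even e" "2 * int j + 2 \<le> ceiling_at k e"
  shows "upper_gf k e j (Suc n) = q ^ (2 * Suc n) * upper_gf k e (Suc j) (Suc n)
     + q ^ (2 * n + 1) * (1 + q ^ (2 * n + 1)) * word_gf k e South_East (2 * int j) n"
proof -
  let ?N = "\<lambda>y. word_gf k e North_East y (Suc n)" and ?D = "word_gf k e South_East (2 * int j) n"
  have eq1: "q ^ (2 * Suc n) = (q * q ^ n) * (q * q ^ n)" and eq2: "q ^ (2 * n + 1) = q * q ^ n * q ^ n"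
    by (simp_all add: mult_2 power_add)
  have k: "2 * int j + 1 \<le> int k"
    using assms(2) ceiling_at_le[of k e] by simp
  have 1: "?N (2 * int j + 1) = q ^ Suc n * ?N (2 * int j + 2) + q ^ n * ?D"
    using assms by (subst word_gf_ascend) (auto simp: add.commute)
  have "q ^ Suc n * ?N (2 * int j + 2) = q ^ Suc n * upper_gf k e (Suc j) (Suc n)
      + q ^ Suc n * (q ^ n * word_gf k e South_East (2 * int j + 1) n)"
    using assms by (subst word_gf_ascend) (auto simp: upper_gf_def algebra_simps)
  also have "word_gf k e South_East (2 * int j + 1) n = q ^ n * ?D"
    by (rule word_gf_descend_odd[OF k])
  finally have "upper_gf k e j (Suc n) = q ^ Suc n * (q ^ Suc n * upper_gf k e (Suc j) (Suc n)
      + q ^ Suc n * (q ^ n * (q ^ n * ?D)) + q ^ n * ?D)"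
    using assms by (simp add: upper_gf_def 1)
  also have "\<dots> = q ^ (2 * Suc n) * upper_gf k e (Suc j) (Suc n)
     + q ^ (2 * n + 1) * (1 + q ^ (2 * n + 1)) * ?D"
    unfolding eq1 eq2 power_Suc by (simp only: algebra_simps mult_1_left)
  finally show ?thesis .
qed

section \<open>Matching the path recurrences with \<open>peak_gf\<close>\<close>

definition level_diff :: "nat \<Rightarrow> nat \<Rightarrow> nat \<Rightarrow> rat fps" where
  "level_diff t j n = peak_gf t j n - q ^ (2 * n) * peak_gf t (below j) n"

text \<open>\<open>level_diff\<close> is the counterpart of \<open>upper_gf\<close>: regrouping the
  three-term recurrence gives the same first-order recurrence as
  \<open>upper_gf_step\<close>.\<close>

lemma level_diff_step:
  assumes "2 * j + 2 \<le> t + 2"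
  shows "level_diff t j (Suc n) = q ^ (2 * Suc n) * level_diff t (Suc j) (Suc n)
    + q ^ (2 * n + 1) * (1 + q ^ (2 * n + 1)) * peak_gf t j n"
proof -
  have 1: "(1 + q ^ (4 * Suc n)) * peak_gf t j (Suc n)
         - q ^ (2 * Suc n) * (peak_gf t (below j) (Suc n) + peak_gf t (j + 1) (Suc n))
       = q ^ (2 * n + 1) * (1 + q ^ (2 * n + 1)) * peak_gf t j n"
    using peak_gf_interior_odd[of j t n] assms by blast
  have 2: "q ^ (4 * Suc n) = q ^ (2 * Suc n) * q ^ (2 * Suc n)"
    by (simp only: power_add[symmetric], rule arg_cong[where f = "(^) q"]) simp
  have 3: "below (Suc j) = j" by (simp add: below_def)
  have "a - Q * b = Q * (c - Q * a) + R" if "(1 + Q * Q) * a - Q * (b + c) = R" for a b c Q R :: "rat fps"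
    using that by (simp add: algebra_simps)
  from this[OF 1[unfolded 2]] show ?thesis
    by (simp only: level_diff_def 3 Suc_eq_plus1[symmetric])
qed

lemma level_diff_top_odd:
  assumes "t + 2 = 2 * j + 1"
  shows "level_diff t j (Suc n) = q ^ (2 * n + 1) * peak_gf t j n"
  using peak_gf_interior_odd[of j t n] assms by (auto simp: level_diff_def below_def)

lemma level_diff_top_even:
  assumes "t + 2 = 2 * j"
  shows "level_diff t j n = 0"
  using peak_gf_top_even[OF assms] assms by (auto simp: level_diff_def below_def)

text \<open>
  After an odd number of pairs of East steps (\<open>i = 1\<close>) the ceiling is lowered by two; this amounts
  to raising the starting height by two.
\<close>

lemma upper_gf_eq_level_diff:
  assumes "i < 2"
    and IH: "\<And>j. 2 * (j + i) \<le> t + 2 \<Longrightarrow> word_gf (t + 2) (2 * i) South_East (2 * int j) n = peak_gf t (j + i) n"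
    and "2 * (j + i) \<le> t + 2"
  shows "upper_gf (t + 2) (2 * i) j (Suc n) = level_diff t (j + i) (Suc n)"
  using assms(3)
\<comment> \<open>Downward induction on the height from the ceiling, where the parity of
  \<open>t\<close> decides which boundary value starts it.\<close>
proof (induction "t + 2 - 2 * (j + i)" arbitrary: j rule: less_induct)
  case less
  have ceil: "ceiling_at (t + 2) (2 * i) = int t + 2 - 2 * int i"
    using assms(1) by (cases i) (auto simp: ceiling_at_def)
  consider "2 * (j + i) + 2 \<le> t + 2" | "t + 2 = 2 * (j + i) + 1" | "t + 2 = 2 * (j + i)"
    using less.prems by linarith
  thus ?case
  proof cases
    case 1
    have "upper_gf (t + 2) (2 * i) (Suc j) (Suc n) = level_diff t (Suc j + i) (Suc n)"
      using 1 by (intro less.hyps) auto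
    moreover have "upper_gf (t + 2) (2 * i) j (Suc n) = q ^ (2 * Suc n) * upper_gf (t + 2) (2 * i) (Suc j) (Suc n)
        + q ^ (2 * n + 1) * (1 + q ^ (2 * n + 1)) * word_gf (t + 2) (2 * i) South_East (2 * int j) n"
      by (rule upper_gf_step) (use 1 ceil in auto)
    moreover have "level_diff t (j + i) (Suc n) = q ^ (2 * Suc n) * level_diff t (Suc j + i) (Suc n)
        + q ^ (2 * n + 1) * (1 + q ^ (2 * n + 1)) * peak_gf t (j + i) n"
      using level_diff_step[OF 1, of n] by (simp only: add_Suc)
    moreover note IH[OF less.prems]
    ultimately show ?thesis by (simp only:)
  next
    case 2
    have "upper_gf (t + 2) (2 * i) j (Suc n) = q ^ (2 * n + 1) * word_gf (t + 2) (2 * i) South_East (2 * int j) n"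
      by (rule upper_gf_top) (use 2 ceil in auto)
    moreover note IH[OF less.prems] level_diff_top_odd[OF 2, of n]
    ultimately show ?thesis by (simp only:)
  next
    case 3
    have "upper_gf (t + 2) (2 * i) j (Suc n) = 0"
      by (rule upper_gf_above) (use 3 ceil in auto)
    with level_diff_top_even[OF 3] show ?thesis by (simp only:)
  qed
qed

text \<open>For fixed \<open>n\<close>, the ascents are known from the values with one peak fewer.
  They determine the two ground values, one for each phase of the East count modulo 4, and from the
  ground the remaining heights follow by induction on \<open>j\<close>.\<close>

theorem word_gf_eq_peak_gf:
  assumes "i < 2" "2 * (j + i) \<le> t + 2"
  shows "word_gf (t + 2) (2 * i) South_East (2 * int j) n = peak_gf t (j + i) n"
  using assms
proof (induction n arbitrary: i j)
  case 0
  have "2 * int j = int (2 * j)" by simp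
  thus ?case by (simp only: word_gf_no_peak peak_gf_no_peak)
next
  case (Suc n)
  let ?D = "\<lambda>i j. word_gf (t + 2) (2 * i) South_East (2 * int j) (Suc n)" and ?Q = "q ^ (2 * Suc n)"
  have upper: "upper_gf (t + 2) (2 * i) j (Suc n) = level_diff t (j + i) (Suc n)"
    if "i < 2" "2 * (j + i) \<le> t + 2" for i j
    using Suc.IH that by (intro upper_gf_eq_level_diff)
  have ground: "?D i 0 = peak_gf t i (Suc n)" if "i < 2" for i
  proof -
    have "?D 0 0 = upper_gf (t + 2) 0 0 (Suc n) + ?Q * ?D 1 0"
      using word_gf_ground[of "Suc n" 0 "t + 2"]
      by (simp only: add_0_left even_zero mult_zero_right mult_1_right zero_less_Suc of_nat_0 simp_thms)
    also have "upper_gf (t + 2) 0 0 (Suc n) = peak_gf t 0 (Suc n) - ?Q * peak_gf t 1 (Suc n)"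
      using upper[of 0 0] by (simp add: level_diff_def below_def del: mult_Suc_right)
    finally have 0: "?D 0 0 - peak_gf t 0 (Suc n) = ?Q * (?D 1 0 - peak_gf t 1 (Suc n))"
      by (simp only: algebra_simps)
    \<comment> \<open>Two further East steps lead from count 2 to 4, which behaves like 0, so the
      two ground values determine each other.\<close>
    have "?D 1 0 = upper_gf (t + 2) 2 0 (Suc n) + ?Q * ?D 0 0"
      using word_gf_ground[of "Suc n" 2 "t + 2"] word_gf_add_4[of "t + 2" 0]
      by (simp add: numeral_2_eq_2[symmetric] del: mult_Suc_right power_Suc One_nat_def)
    also have "upper_gf (t + 2) 2 0 (Suc n) = peak_gf t 1 (Suc n) - ?Q * peak_gf t 0 (Suc n)"
      using upper[of 1 0] by (simp add: level_diff_def below_def del: mult_Suc_right One_nat_def)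
    finally have 1: "?D 1 0 - peak_gf t 1 (Suc n) = ?Q * (?D 0 0 - peak_gf t 0 (Suc n))"
      by (simp only: algebra_simps)
    \<comment> \<open>Inserting one relation into the other leaves a homogeneous equation whose
      factor \<open>1 - ?Q * ?Q\<close> has constant coefficient 1.\<close>
    have "(1 - ?Q * ?Q) * (?D 0 0 - peak_gf t 0 (Suc n)) = 0"
      using 0 unfolding 1 by (simp only: algebra_simps right_minus_eq mult_1_left add_0_left)
    moreover have "fps_nth (1 - ?Q * ?Q) 0 \<noteq> 0"
      by simp
    hence "1 - ?Q * ?Q \<noteq> 0" by (metis fps_zero_nth)
    ultimately have "?D 0 0 = peak_gf t 0 (Suc n)"
      by simp
    with 1 have "?D 0 0 = peak_gf t 0 (Suc n)" "?D 1 0 = peak_gf t 1 (Suc n)"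
      by simp_all
    moreover have "i = 0 \<or> i = 1" using that by auto
    ultimately show ?thesis by metis
  qed
  show ?case using Suc.prems
  proof (induction j)
    case 0
    thus ?case using ground by simp
  next
    case (Suc j)
    have "?D i (Suc j) = upper_gf (t + 2) (2 * i) (Suc j) (Suc n) + ?Q * ?D i j"
      using Suc.prems by (intro word_gf_descend_even) auto
    also have "\<dots> = level_diff t (Suc j + i) (Suc n) + ?Q * peak_gf t (j + i) (Suc n)"
    proof -
      have "?D i j = peak_gf t (j + i) (Suc n)"
        by (rule Suc.IH) (use Suc.prems in auto)
      with upper[OF Suc.prems] show ?thesis by (simp only:)
    qed
    also have "\<dots> = peak_gf t (Suc j + i) (Suc n)"
      by (simp add: level_diff_def below_def)
    finally show ?case .
  qed
qed

section \<open>Relative heights and valleys\<close>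

lemma height_0 [simp]: "height s ws 0 = s"
  by (simp add: height_def)

lemma height_Suc: "x < length ws \<Longrightarrow> height s ws (Suc x) = height s ws x + rise (ws ! x)"
  by (simp add: height_def take_Suc_conv_app_nth)

lemma east_steps_before_0 [simp]: "east_steps_before ws 0 = 0"
  by (simp add: east_steps_before_def)

lemma east_steps_before_Suc:
  "x < length ws \<Longrightarrow>
     east_steps_before ws (Suc x) = east_steps_before ws x + (if ws ! x = East then 1 else 0)"
  by (simp add: east_steps_before_def take_Suc_conv_app_nth)

text \<open>North-East and South-East steps change \<open>x\<close> plus the height by 2 or 0, while
  an East step changes both \<open>x\<close> and the East count by 1.\<close>

lemma parity_invariant:
  "x \<le> length ws \<Longrightarrow> even (int x + height s ws x + s + int (east_steps_before ws x))"
proof (induction x)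
  case (Suc x)
  thus ?case by (cases "ws ! x") (auto simp: height_Suc east_steps_before_Suc)
qed simp

lemma height_Suc_le: "x < length ws \<Longrightarrow> height s ws (Suc x) \<le> height s ws x + 1"
  by (cases "ws ! x") (auto simp: height_Suc)

lemma height_Suc_ge: "x < length ws \<Longrightarrow> height s ws (Suc x) \<ge> height s ws x - 1"
  by (cases "ws ! x") (auto simp: height_Suc)

text \<open>A discrete intermediate value argument: heights drop by at most 1 per step, so the first
  vertex not above \<open>c\<close> lies exactly at \<open>c\<close>. \<open>last_ascent\<close> is
  its mirror image.\<close>

lemma first_descent:
  assumes "a \<le> b" "b \<le> length ws" "height s ws a > c" "height s ws b \<le> c"
  obtains z where "a < z" "z \<le> b" "height s ws z = c" "\<And>y. a \<le> y \<Longrightarrow> y < z \<Longrightarrow> height s ws y > c"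
proof -
  let ?P = "\<lambda>z. a \<le> z \<and> height s ws z \<le> c"
  define z where "z = (LEAST z. ?P z)"
  have z: "a \<le> z" "height s ws z \<le> c"
    using LeastI[of ?P b] assms unfolding z_def by auto
  have zb: "z \<le> b"
    using Least_le[of ?P b] assms unfolding z_def by auto
  have above: "height s ws y > c" if "a \<le> y" "y < z" for y
    using not_less_Least[of y ?P] that unfolding z_def by auto
  have az: "a < z"
    using z assms(3) by (metis le_neq_implies_less not_le)
  then obtain y where y: "z = Suc y" by (cases z) auto
  have "height s ws y > c" using above az y by simp
  hence "height s ws z = c"
    using height_Suc_ge[of y ws s] z(2) zb assms(2) y by simp
  thus ?thesis using that az zb above by blast
qed

lemma last_ascent:
  assumes "a \<le> b" "b \<le> length ws" "height s ws a \<le> c" "height s ws b > c"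
  obtains z where "a \<le> z" "z < b" "height s ws z = c" "\<And>y. z < y \<Longrightarrow> y \<le> b \<Longrightarrow> height s ws y > c"
proof -
  let ?P = "\<lambda>z. z \<le> b \<and> height s ws z \<le> c"
  define z where "z = (GREATEST z. ?P z)"
  have P: "?P a" using assms by simp
  have z: "z \<le> b" "height s ws z \<le> c"
    using GreatestI_nat[of ?P a b, OF P] unfolding z_def by auto
  have az: "a \<le> z"
    using Greatest_le_nat[of ?P a b, OF P] unfolding z_def by auto
  have above: "height s ws y > c" if "z < y" "y \<le> b" for y
    using Greatest_le_nat[of ?P y b] that unfolding z_def by fastforce
  have zb: "z < b"
    using z assms(4) by (metis le_neq_implies_less not_le)
  have "height s ws (Suc z) > c" using above zb by simp
  hence "height s ws z = c"
    using height_Suc_le[of z ws s] z(2) zb assms(2) by simp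
  thus ?thesis using that az zb above by blast
qed

text \<open>The lower endpoints force the leftmost maximum into the interior. It is entered by a
  North-East step because everything to its left is lower; its positive height excludes East and its
  maximality excludes North-East as the next step.\<close>

lemma leftmost_highest_is_peak:
  assumes "lattice_path s ws" "u < y" "y < w" "w \<le> length ws"
    and "height s ws u < height s ws y" "height s ws w < height s ws y"
  obtains p where "p \<in> peaks ws" "u < p" "p < w"
    "\<And>x. u \<le> x \<Longrightarrow> x \<le> w \<Longrightarrow> height s ws x \<le> height s ws p"
    "\<And>x. u \<le> x \<Longrightarrow> x < p \<Longrightarrow> height s ws x < height s ws p"
proof -
  let ?H = "height s ws"
  define M where "M = Max (?H ` {u..w})"
  have fin: "finite (?H ` {u..w})" by simp
  have ne: "?H ` {u..w} \<noteq> {}" using assms by simp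
  have le_M: "?H x \<le> M" if "u \<le> x" "x \<le> w" for x
    unfolding M_def using that by (intro Max_ge) auto
  let ?P = "\<lambda>x. u \<le> x \<and> ?H x = M"
  define p where "p = (LEAST x. ?P x)"
  obtain x where x: "u \<le> x" "x \<le> w" "?H x = M"
    using Max_in[OF fin ne] unfolding M_def by auto
  have p: "u \<le> p" "?H p = M"
    using LeastI[of ?P x] x unfolding p_def by auto
  have "p \<le> x"
    using Least_le[of ?P x] x unfolding p_def by auto
  hence pw: "p \<le> w" using x by simp
  have left: "?H x < ?H p" if "u \<le> x" "x < p" for x
    using not_less_Least[of x ?P] le_M[of x] that pw p(2) unfolding p_def by fastforce
  have "?H y \<le> ?H p" using le_M[of y] p assms by simp
  hence "p \<noteq> u" "p \<noteq> w" using assms by auto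
  hence up: "u < p" "p < w" using p pw by auto
  then obtain r where r: "p = Suc r" by (cases p) auto
  have "?H r < ?H p" using left[of r] up r by simp
  hence r_NE: "ws ! r = North_East"
    using height_Suc[of r ws s] r up assms(4) by (cases "ws ! r") auto
  have "?H (Suc p) \<le> ?H p" using le_M[of "Suc p"] up p by simp
  hence "ws ! p \<noteq> North_East"
    using height_Suc[of p ws s] up assms(4) by (cases "ws ! p") auto
  moreover have "?H p > 0"
  proof -
    have "?H r \<ge> 0"
      using assms(1,4) r up by (simp add: lattice_path_def)
    with \<open>?H r < ?H p\<close> show ?thesis by simp
  qed
  hence "ws ! p \<noteq> East"
    using assms(1,4) up by (auto simp: lattice_path_def)
  ultimately have "ws ! p = South_East" by (cases "ws ! p") auto
  hence "p \<in> peaks ws" using r_NE r up assms(4) by (simp add: peaks_def)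
  thus ?thesis using that up left le_M p by metis
qed

lemma east_steps_before_eq:
  assumes "a \<le> b" "b \<le> length ws" "\<And>y. a \<le> y \<Longrightarrow> y < b \<Longrightarrow> ws ! y \<noteq> East"
  shows "east_steps_before ws b = east_steps_before ws a"
  using assms
proof (induction b rule: dec_induct)
  case (step b)
  thus ?case by (simp add: east_steps_before_Suc)
qed simp

definition spans :: "int \<Rightarrow> step list \<Rightarrow> nat \<Rightarrow> int \<Rightarrow> nat \<Rightarrow> nat \<Rightarrow> bool" where
  "spans s ws x h x' x'' \<longleftrightarrow> x' < x \<and> x < x'' \<and> x'' \<le> length ws \<and>
        height s ws x' = height s ws x - h \<and>
        height s ws x'' = height s ws x - h \<and>
        (\<forall>p\<in>peaks ws. x' < p \<and> p < x'' \<longrightarrow>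
           \<not> height s ws p > height s ws x \<and>
           (height s ws p = height s ws x \<longrightarrow> p \<ge> x))"

lemma relative_height_spans: "relative_height s ws x = (GREATEST h. \<exists>x' x''. spans s ws x h x' x'')"
  unfolding relative_height_def spans_def ..

text \<open>The conditions that the automaton checks at each North-East step. The clause
  \<open>x > 0\<close> makes the starting vertex count as a valley.\<close>

definition locally_admissible :: "int \<Rightarrow> step list \<Rightarrow> nat \<Rightarrow> bool" where
  "locally_admissible s ws k \<longleftrightarrow>
     (\<forall>x<length ws. ws ! x = North_East \<longrightarrow> even (east_steps_before ws x)
        \<and> (x > 0 \<and> ws ! (x - 1) = North_East \<or> even (height s ws x))
        \<and> height s ws (Suc x) \<le> ceiling_at k (east_steps_before ws x))"

definition globally_admissible :: "int \<Rightarrow> step list \<Rightarrow> nat \<Rightarrow> bool" where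
  "globally_admissible s ws k \<longleftrightarrow>
        (\<forall>x\<le>length ws. height s ws x \<le> int k) \<and>
        (\<forall>x\<in>peaks ws. relative_height s ws x \<in> {int k, int k - 1} \<longrightarrow>
           4 dvd east_steps_before ws x) \<and>
        (\<forall>x\<in>peaks ws. int x mod 2 = relative_height s ws x mod 2)"

section \<open>Relative heights in a fixed lattice path\<close>

context
  fixes s :: int and ws :: "step list"
  assumes path: "lattice_path s ws"
begin

abbreviation "H \<equiv> height s ws"
abbreviation "E \<equiv> east_steps_before ws"

lemma height_nonneg: "x \<le> length ws \<Longrightarrow> H x \<ge> 0"
  using path by (simp add: lattice_path_def)

lemma East_height: "x < length ws \<Longrightarrow> ws ! x = East \<Longrightarrow> H x = 0"
  using path by (simp add: lattice_path_def)

lemma height_end: "H (length ws) = 0"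
  using path by (simp add: lattice_path_def)

lemma east_steps_before_const:
  assumes "a \<le> b" "b \<le> length ws" "\<And>y. a \<le> y \<Longrightarrow> y < b \<Longrightarrow> H y > 0"
  shows "E b = E a"
proof (rule east_steps_before_eq[OF assms(1,2)])
  fix y assume "a \<le> y" "y < b"
  hence "H y > 0" "y < length ws" using assms by auto
  thus "ws ! y \<noteq> East" using East_height[of y] by auto
qed

lemma spans_le_height: "spans s ws x h x' x'' \<Longrightarrow> h \<le> H x"
  using height_nonneg[of x''] by (auto simp: spans_def)

lemma peak_neighbours:
  assumes "x \<in> peaks ws"
  shows "x > 0" "x < length ws" "H (x - 1) = H x - 1" "H (Suc x) = H x - 1"
  using assms height_Suc[of "x - 1" ws s] height_Suc[of x ws s] by (auto simp: peaks_def)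

text \<open>\<open>GREATEST\<close> is meaningful only if a maximum exists: the two neighbours of a
  peak realise \<open>h = 1\<close>, and nonnegativity of heights bounds \<open>h\<close> by the
  height of the peak, so the candidates \<open>h \<ge> 1\<close> form a finite nonempty set.\<close>

lemma relative_height_greatest:
  assumes "x \<in> peaks ws"
  shows "\<exists>x' x''. spans s ws x (relative_height s ws x) x' x''"
    and "spans s ws x h x' x'' \<Longrightarrow> h \<le> relative_height s ws x"
    and "relative_height s ws x \<ge> 1"
proof -
  let ?A = "{h. h \<ge> 1 \<and> (\<exists>x' x''. spans s ws x h x' x'')}"
  have "\<exists>x' x''. spans s ws x 1 x' x''"
    using peak_neighbours[OF assms] unfolding spans_def
    by (intro exI[of _ "x - 1"] exI[of _ "Suc x"]) (auto simp: less_Suc_eq)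
  hence 1: "1 \<in> ?A" by simp
  have "?A \<subseteq> {1..H x}" using spans_le_height by auto
  hence fin: "finite ?A" by (rule finite_subset) simp
  have in_A: "Max ?A \<in> ?A" using fin 1 by (intro Max_in) auto
  have ge: "h \<le> Max ?A" if "spans s ws x h x' x''" for h x' x''
  proof (cases "h \<ge> 1")
    case True
    thus ?thesis using that fin by (intro Max_ge) auto
  next
    case False
    thus ?thesis using Max_ge[OF fin 1] by simp
  qed
  have eq: "relative_height s ws x = Max ?A"
    unfolding relative_height_spans
    by (rule Greatest_equality) (use in_A ge in auto)
  show "\<exists>x' x''. spans s ws x (relative_height s ws x) x' x''" 
    "relative_height s ws x \<ge> 1"
    using in_A unfolding eq by auto
  show "spans s ws x h x' x'' \<Longrightarrow> h \<le> relative_height s ws x"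
    unfolding eq by (rule ge)
qed

lemma relative_height_le: "x \<in> peaks ws \<Longrightarrow> relative_height s ws x \<le> H x"
  using relative_height_greatest(1) spans_le_height by blast

text \<open>
  If every valley has even height, an interval witnessing an odd base level can be enlarged on
  both sides, so it does not give the greatest \<open>h\<close>.
\<close>

lemma even_base:
  assumes valleys: "\<And>x. x < length ws \<Longrightarrow> ws ! x = North_East \<Longrightarrow>
        x > 0 \<and> ws ! (x - 1) = North_East \<or> even (H x)"
    and "even s" and x: "x \<in> peaks ws"
  shows "even (H x - relative_height s ws x)"
proof (rule ccontr)
  define r where "r = relative_height s ws x"
  define b where "b = H x - r"
  assume "odd (H x - relative_height s ws x)"
  hence b: "odd b" by (simp add: b_def r_def)
  have r: "r \<ge> 1" using relative_height_greatest(3)[OF x] by (simp add: r_def)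
  obtain x' x'' where sp: "spans s ws x r x' x''"
    using relative_height_greatest(1)[OF x] unfolding r_def by blast
  have lt: "x' < x" "x < x''" "x'' \<le> length ws" and Hb: "H x' = b" "H x'' = b"
    and pk: "\<And>p. p \<in> peaks ws \<Longrightarrow> x' < p \<Longrightarrow> p < x'' \<Longrightarrow> H p < H x \<or> H p = H x \<and> p \<ge> x"
    using sp unfolding spans_def b_def by (auto simp: not_less order_le_less)
  have "b \<ge> 0" using height_nonneg[of x''] lt Hb by simp
  hence b1: "b \<ge> 1" using b by presburger
  \<comment> \<open>If the path climbs into \<open>x'\<close>, the vertex before \<open>x'\<close>
    serves. Otherwise the odd height excludes a North-East step at \<open>x'\<close> and the
    positive height an East step, so the vertex after \<open>x'\<close> is one lower. The right end
    is handled in the same way.\<close>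
  have "\<exists>y'. y' < x \<and> x' - 1 \<le> y' \<and> H y' = b - 1"
  proof -
    have "x' > 0" using Hb(1) b assms(2) by (cases x') auto
    then obtain z where z: "x' = Suc z" by (cases x') auto
    have zl: "z < length ws" "x' < length ws" using lt z by auto
    show ?thesis
    proof (cases "ws ! z = North_East")
      case True
      hence "H z = b - 1" using height_Suc[of z ws s] zl Hb z by simp
      thus ?thesis using lt z by (intro exI[of _ z]) auto
    next
      case False
      hence "ws ! x' \<noteq> North_East" using valleys[of x'] zl z Hb b by auto
      moreover have "ws ! x' \<noteq> East" using East_height[of x'] zl Hb b1 by auto
      ultimately have "ws ! x' = South_East" by (cases "ws ! x'") auto
      hence *: "H (Suc x') = b - 1" using height_Suc[of x' ws s] zl Hb by simp
      have "Suc x' \<noteq> x" using * r unfolding b_def by auto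
      thus ?thesis using lt * by (intro exI[of _ "Suc x'"]) auto
    qed
  qed
  then obtain y' where y': "y' < x" "x' - 1 \<le> y'" "H y' = b - 1" by blast
  have "\<exists>y''. x < y'' \<and> y'' \<le> Suc x'' \<and> y'' \<le> length ws \<and> H y'' = b - 1"
  proof -
    obtain z where z: "x'' = Suc z" using lt by (cases x'') auto
    have "x'' \<noteq> length ws" using Hb height_end b1 by auto
    hence zl: "z < length ws" "x'' < length ws" using lt z by auto
    show ?thesis
    proof (cases "ws ! z = North_East")
      case True
      hence *: "H z = b - 1" using height_Suc[of z ws s] zl Hb z by simp
      have "z \<noteq> x" using * r unfolding b_def by auto
      thus ?thesis using lt z * by (intro exI[of _ z]) auto
    next
      case False
      hence "ws ! x'' \<noteq> North_East" using valleys[of x''] zl z Hb b by auto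
      moreover have "ws ! x'' \<noteq> East" using East_height[of x''] zl Hb b1 by auto
      ultimately have "ws ! x'' = South_East" by (cases "ws ! x''") auto
      hence *: "H (Suc x'') = b - 1" using height_Suc[of x'' ws s] zl Hb by simp
      thus ?thesis using lt zl by (intro exI[of _ "Suc x''"]) auto
    qed
  qed
  then obtain y'' where y'': "x < y''" "y'' \<le> Suc x''" "y'' \<le> length ws" "H y'' = b - 1" by blast
  have "spans s ws x (r + 1) y' y''"
    unfolding spans_def
  proof (intro conjI ballI impI)
    show "H y' = H x - (r + 1)" "H y'' = H x - (r + 1)"
      using y' y'' by (simp_all add: b_def)
    fix p assume p: "p \<in> peaks ws" "y' < p \<and> p < y''"
    have "H p < H x \<or> H p = H x \<and> p \<ge> x"
    proof (cases "x' < p \<and> p < x''")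
      case True
      thus ?thesis using pk p by blast
    next
      \<comment> \<open>The new interval reaches at most one step beyond the old one, so only
        \<open>x'\<close> and \<open>x''\<close> can be newly enclosed, and both lie below
        \<open>x\<close>.\<close>
      case False
      hence "p = x' \<or> p = x''" using p y' y'' by auto
      thus ?thesis using Hb r unfolding b_def by auto
    qed
    thus "\<not> H x < H p" "H p = H x \<Longrightarrow> x \<le> p" by auto
  qed (use y' y'' in auto)
  from relative_height_greatest(2)[OF x this] show False
    unfolding r_def by simp
qed

lemma spans_leftmost_highest:
  assumes "u < p" "p < w" "w \<le> length ws" "H u = c" "H w = c"
    and max: "\<And>x. u \<le> x \<Longrightarrow> x \<le> w \<Longrightarrow> H x \<le> H p"
    and left: "\<And>x. u \<le> x \<Longrightarrow> x < p \<Longrightarrow> H x < H p"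
  shows "spans s ws p (H p - c) u w"
  unfolding spans_def
proof (intro conjI ballI impI)
  fix t assume t: "u < t \<and> t < w"
  show "\<not> H p < H t" using max[of t] t by simp
  show "p \<le> t" if "H t = H p" using left[of t] t that by (cases "p \<le> t") auto
qed (use assms in auto)

text \<open>The two ground points witness for the leftmost highest peak between them the largest
  relative height possible, its own height.\<close>

lemma peak_over_ground:
  assumes "z < y" "y < w" "w \<le> length ws" "H z = 0" "H w = 0" "H y > 0"
  obtains p where "p \<in> peaks ws" "z < p" "p < w" "H y \<le> H p" "relative_height s ws p = H p"
proof -
  obtain p where p: "p \<in> peaks ws" "z < p" "p < w"
    and max: "\<And>x. z \<le> x \<Longrightarrow> x \<le> w \<Longrightarrow> H x \<le> H p"
    and left: "\<And>x. z \<le> x \<Longrightarrow> x < p \<Longrightarrow> H x < H p"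
    using leftmost_highest_is_peak[OF path, of z y w] assms by auto
  have "spans s ws p (H p) z w"
    using spans_leftmost_highest[of z p w 0] p assms max left by simp
  hence "relative_height s ws p = H p"
    using relative_height_greatest(2)[OF p(1)] relative_height_le[OF p(1)] by (simp add: order_antisym)
  thus ?thesis using that p max[of y] assms by simp
qed

section \<open>Equivalence of the global and the local conditions\<close>

lemma globally_admissible_if_locally:
  assumes loc: "locally_admissible s ws k" and "even s" "s \<le> int k"
  shows "globally_admissible s ws k"
  unfolding globally_admissible_def
proof (intro conjI ballI impI allI)
  fix x assume "x \<le> length ws"
  thus "H x \<le> int k"
  proof (induction x)
    case (Suc x)
    show ?case
    proof (cases "ws ! x = North_East")
      case True
      hence "H (Suc x) \<le> ceiling_at k (E x)"
        using loc Suc.prems unfolding locally_admissible_def by auto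
      thus ?thesis by (auto simp: ceiling_at_def split: if_splits)
    next
      case False
      thus ?thesis using Suc height_Suc[of x ws s] by (cases "ws ! x") auto
    qed
  qed (simp add: assms)
next
  fix x assume x: "x \<in> peaks ws"
  then obtain z where z: "x = Suc z" "z < length ws" "ws ! z = North_East"
    by (cases x) (auto simp: peaks_def)
  have E: "E x = E z" "even (E x)" and ceil: "H x \<le> ceiling_at k (E x)"
    using loc z east_steps_before_Suc[of z ws] unfolding locally_admissible_def by auto
  have "even (H x - relative_height s ws x)"
    using even_base[OF _ assms(2) x] loc unfolding locally_admissible_def by blast
  moreover have "even (int x + H x + s + int (E x))"
    using parity_invariant x by (simp add: peaks_def)
  ultimately have "even (int x - relative_height s ws x)"
    using E(2) assms(2) by auto
  thus "int x mod 2 = relative_height s ws x mod 2" 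
    by presburger
  assume "relative_height s ws x \<in> {int k, int k - 1}"
  \<comment> \<open>Such a peak exceeds \<open>k - 2\<close>, so the ceiling at its position must be
    \<open>k\<close>.\<close>
  hence "H x \<ge> int k - 1"
    using relative_height_le[OF x] by auto
  thus "4 dvd E x" using ceil by (auto simp: ceiling_at_def split: if_splits)
qed

text \<open>Before the path first touches the ground there is no East step. Otherwise the step lies
  in an excursion between consecutive ground points \<open>z\<close> and \<open>w\<close>, where the
  East count is constant; the conditions on the highest peak of the excursion, whose relative height
  is its height, then control every step in it.\<close>

lemma north_east_step_bounds:
  assumes glob: "globally_admissible s ws k" and "even s"
    and x: "x < length ws" "ws ! x = North_East"
  shows "even (E x)" "H (Suc x) \<le> ceiling_at k (E x)"
proof -
  have "even (E x) \<and> H (Suc x) \<le> ceiling_at k (E x)"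
  proof (cases "\<exists>y\<le>x. H y \<le> 0")
    case False
    have "H y > 0" if "y \<le> x" for y
      using False that by (meson not_le)
    hence "E x = E 0"
      by (intro east_steps_before_const) (use x in auto)
    moreover have "H (Suc x) \<le> int k"
      using glob x by (auto simp: globally_admissible_def)
    ultimately show ?thesis by (simp add: ceiling_at_def)
  next
    case True
    then obtain y where y: "y \<le> x" "H y \<le> 0" by blast
    have pos: "H (Suc x) > 0"
      using height_Suc[of x ws s] x height_nonneg[of x] by simp
    obtain z where z: "z < Suc x" "H z = 0" "\<And>y. z < y \<Longrightarrow> y \<le> Suc x \<Longrightarrow> H y > 0"
      using last_ascent[of y "Suc x" ws s 0] y pos x by auto
    obtain w where w: "Suc x < w" "w \<le> length ws" "H w = 0" "\<And>y. Suc x \<le> y \<Longrightarrow> y < w \<Longrightarrow> H y > 0"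
      using first_descent[of "Suc x" "length ws" ws 0 s] pos x height_end by auto
    have above: "H y > 0" if "z < y" "y < w" for y
      using z(3)[of y] w(4)[of y] that by (cases "y \<le> Suc x") auto
    obtain p where p: "p \<in> peaks ws" "z < p" "p < w" "H (Suc x) \<le> H p" "relative_height s ws p = H p"
      using peak_over_ground[of z "Suc x" w] z(1,2) w(1-3) pos by blast
    \<comment> \<open>The comparison starts at \<open>Suc z\<close> because the height is
      \<open>0\<close> at \<open>z\<close>. Since \<open>x\<close> may equal \<open>z\<close>, its
      count is reached through \<open>Suc x\<close>.\<close>
    have E_eq: "E u = E (Suc z)" if "z < u" "u < w" for u
      by (rule east_steps_before_const) (use that w above in auto)
    have Ep: "E x = E p"
      using E_eq[of p] E_eq[of "Suc x"] p z(1) w(1) x by (simp add: east_steps_before_Suc)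
    have "even (int p + H p + s + int (E p))"
      using parity_invariant p w by simp
    moreover have "even (int p - H p)"
      using glob p unfolding globally_admissible_def by (auto simp: mod_eq_dvd_iff)
    ultimately have "even (E p)" using assms(2) by auto
    moreover have "H (Suc x) \<le> ceiling_at k (E p)"
    proof (cases "4 dvd E p")
      case True
      have "H (Suc x) \<le> int k"
        using glob x by (auto simp: globally_admissible_def)
      with True show ?thesis by (simp add: ceiling_at_def)
    next
      case False
      hence "H p \<noteq> int k" "H p \<noteq> int k - 1"
        using glob p unfolding globally_admissible_def by auto
      moreover have "H p \<le> int k"
        using glob p w by (auto simp: globally_admissible_def)
      ultimately show ?thesis using False p by (simp add: ceiling_at_def)
    qed
    ultimately show ?thesis using Ep by simp
  qed
  thus "even (E x)" "H (Suc x) \<le> ceiling_at k (E x)" by auto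
qed

text \<open>
  The elder rule: a valley is the base of the lower of the highest peaks on its two sides.
\<close>

lemma valley_is_base:
  assumes v: "0 < v" "v < length ws" "ws ! v = North_East" "ws ! (v - 1) = South_East" "H v > 0"
  obtains p where "p \<in> peaks ws" "relative_height s ws p = H p - H v" "E p = E v"
proof -
  have up: "H (Suc v) = H v + 1"
    using height_Suc[of v ws s] v by simp
  obtain w where w: "Suc v < w" "w \<le> length ws" "H w = H v" "\<And>y. Suc v \<le> y \<Longrightarrow> y < w \<Longrightarrow> H y > H v"
    using first_descent[of "Suc v" "length ws" ws "H v" s] up v height_end by auto
  obtain p where p: "p \<in> peaks ws" "v < p" "p < w"
    and max: "\<And>x. v \<le> x \<Longrightarrow> x \<le> w \<Longrightarrow> H x \<le> H p"
    and left: "\<And>x. v \<le> x \<Longrightarrow> x < p \<Longrightarrow> H x < H p"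
    using leftmost_highest_is_peak[OF path, of v "Suc v" w] w(1-3) up by auto
  have right_ge: "H y \<ge> H v" if "v \<le> y" "y \<le> w" for y
    using w(3) w(4)[of y] that by (cases "y = v"; cases "y = w") auto
  have E_right: "E p = E v"
  proof (rule east_steps_before_const)
    fix y assume "v \<le> y" "y < p"
    thus "H y > 0" using right_ge[of y] p v(5) by simp
  qed (use p w in auto)
  have "spans s ws p (H p - H v) v w"
    using spans_leftmost_highest[of v p w "H v"] p w(2,3) max left by simp
  hence ge: "H p - H v \<le> relative_height s ws p"
    by (rule relative_height_greatest(2)[OF p(1)])
  show ?thesis
  proof (cases "relative_height s ws p = H p - H v")
    case True
    thus ?thesis using that p E_right by blast
  next
    \<comment> \<open>If the base of \<open>p\<close> is lower than the valley, its witness interval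
      extends to the left beyond \<open>v\<close>, and all peaks of that part are lower than
      \<open>p\<close>. The peak sought is then the highest one, \<open>t\<close>, on the last
      stretch left of \<open>v\<close> that stays at or above the height of
      \<open>v\<close>.\<close>
    case False
    obtain x1 x2 where sp: "spans s ws p (relative_height s ws p) x1 x2"
      using relative_height_greatest(1)[OF p(1)] by blast
    have x1: "x1 < p" "p < x2" "H x1 < H v"
      and pk: "\<And>t. t \<in> peaks ws \<Longrightarrow> x1 < t \<Longrightarrow> t < p \<Longrightarrow> H t < H p"
      using sp ge False unfolding spans_def by force+
    have "x1 < v"
      using x1 right_ge[of x1] p by (cases "x1 < v") auto
    obtain z where z: "x1 \<le> z" "z < v" "H z = H v - 1" "\<And>y. z < y \<Longrightarrow> y \<le> v \<Longrightarrow> H y > H v - 1"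
      using last_ascent[of x1 v ws s "H v - 1"] \<open>x1 < v\<close> x1 v by auto
    have Hu: "H (Suc z) = H v"
      using z(2,3) z(4)[of "Suc z"] height_Suc_le[of z ws s] v by simp
    have Hv1: "H (v - 1) = H v + 1"
      using height_Suc[of "v - 1" ws s] v by simp
    have "Suc z \<noteq> v - 1" "z \<noteq> v - 1" using Hu Hv1 z(3) by auto
    hence zv: "Suc z < v - 1" "v - 1 < v" using z(2) by auto
    obtain t where t: "t \<in> peaks ws" "Suc z < t" "t < v"
      and maxt: "\<And>x. Suc z \<le> x \<Longrightarrow> x \<le> v \<Longrightarrow> H x \<le> H t"
      and leftt: "\<And>x. Suc z \<le> x \<Longrightarrow> x < t \<Longrightarrow> H x < H t"
      using leftmost_highest_is_peak[OF path, of "Suc z" "v - 1" v] zv Hu Hv1 v by auto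
    have "H t < H p" using pk[of t] t z p by simp
    have "spans s ws t (H t - H v) (Suc z) v"
      using spans_leftmost_highest[of "Suc z" t v "H v"] t Hu v maxt leftt by simp
    hence "H t - H v \<le> relative_height s ws t"
      by (rule relative_height_greatest(2)[OF t(1)])
    \<comment> \<open>An interval for \<open>t\<close> with a lower base would have to end beyond
      \<open>p\<close>, since the path stays at or above the valley between \<open>t\<close> and
      \<open>p\<close>; but it cannot contain the higher peak \<open>p\<close>.\<close>
    moreover have "relative_height s ws t \<le> H t - H v"
    proof (rule ccontr)
      assume gt: "\<not> relative_height s ws t \<le> H t - H v"
      obtain t1 t2 where "spans s ws t (relative_height s ws t) t1 t2"
        using relative_height_greatest(1)[OF t(1)] by blast
      hence t2: "t1 < t" "t < t2" "H t2 < H v" and "\<not> (p < t2 \<and> t1 < p \<and> H p > H t)"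
        using gt p(1) unfolding spans_def by auto
      hence "t2 \<le> p" using \<open>H t < H p\<close> t p by auto
      hence "H t2 \<ge> H v"
        using z(4)[of t2] right_ge[of t2] t t2 p by (cases "t2 \<le> v") auto
      with t2 show False by simp
    qed
    moreover have "E v = E t"
    proof (rule east_steps_before_const)
      fix y assume "t \<le> y" "y < v"
      thus "H y > 0" using z(4)[of y] t v(5) by simp
    qed (use t v in auto)
    ultimately show ?thesis using that t by simp
  qed
qed

lemma locally_admissible_if_globally:
  assumes glob: "globally_admissible s ws k" and "even s"
  shows "locally_admissible s ws k"
  unfolding locally_admissible_def
proof (intro allI impI conjI)
  fix x assume x: "x < length ws" "ws ! x = North_East"
  note bounds = north_east_step_bounds[OF assms x]
  show "even (E x)" "H (Suc x) \<le> ceiling_at k (E x)" by fact+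
  show "0 < x \<and> ws ! (x - 1) = North_East \<or> even (H x)"
  proof (rule ccontr)
    assume *: "\<not> (0 < x \<and> ws ! (x - 1) = North_East \<or> even (H x))"
    have x0: "x > 0" using * assms(2) by (cases x) auto
    have "H x > 0" using * height_nonneg[of x] x by (cases "H x = 0") auto
    moreover have "ws ! (x - 1) \<noteq> East"
    proof
      assume "ws ! (x - 1) = East"
      hence "H (x - 1) = 0" "H (Suc (x - 1)) = H (x - 1)"
        using East_height[of "x - 1"] height_Suc[of "x - 1" ws s] x x0 by auto
      with \<open>H x > 0\<close> x0 show False by simp
    qed
    ultimately have "ws ! (x - 1) = South_East"
      using * x0 by (cases "ws ! (x - 1)") auto
    then obtain p where p: "p \<in> peaks ws" "relative_height s ws p = H p - H x" "E p = E x"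
      using valley_is_base[OF x0 x] \<open>H x > 0\<close> by blast
    \<comment> \<open>As \<open>s\<close> and \<open>E p\<close> are even, the invariant makes
      \<open>p + H p\<close> even, while the peak condition makes \<open>p + H p + H x\<close> even;
      so \<open>H x\<close> would be even.\<close>
    have "even (int p + H p + s + int (E p))"
      using parity_invariant p by (simp add: peaks_def)
    moreover have "even (int p - (H p - H x))"
      using glob p unfolding globally_admissible_def by (metis mod_eq_dvd_iff)
    ultimately show False using * bounds p assms(2) by auto
  qed
qed

lemma globally_iff_locally_admissible:
  assumes "even s" "s \<le> int k"
  shows "globally_admissible s ws k \<longleftrightarrow> locally_admissible s ws k"
  using globally_admissible_if_locally locally_admissible_if_globally assms by blast

end

section \<open>Counting the paths\<close>

lemma height_Cons_Suc: "height y (w # ws) (Suc x) = height (y + rise w) ws x"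
  by (simp add: height_def)

lemma east_steps_before_Cons_Suc:
  "east_steps_before (w # ws) (Suc x) = (if w = East then 1 else 0) + east_steps_before ws x"
  by (simp add: east_steps_before_def)

lemma all_le_Suc_iff: "(\<forall>x\<le>Suc n. P x) \<longleftrightarrow> P 0 \<and> (\<forall>x\<le>n. P (Suc x))"
  using All_less_Suc2[of "Suc n" P] by (simp add: less_Suc_eq_le)

text \<open>\<open>(p # ws) ! x\<close> is the step entering vertex \<open>x\<close>, so that the
  state of the automaton is expressed by positions in the word and \<open>last (p # ws)\<close> also
  covers the empty word.\<close>

lemma accepts_iff:
  assumes "0 \<le> y"
  shows "accepts k e p y ws \<longleftrightarrow>
     (\<forall>x\<le>length ws. height y ws x \<ge> 0) \<and>
     (\<forall>x<length ws. ws ! x = East \<longrightarrow> height y ws x = 0) \<and>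
     height y ws (length ws) = 0 \<and> last (p # ws) = South_East \<and>
     (\<forall>x<length ws. ws ! x = North_East \<longrightarrow> even (e + east_steps_before ws x) \<and>
        ((p # ws) ! x = North_East \<or> even (height y ws x)) \<and>
        height y ws (Suc x) \<le> ceiling_at k (e + east_steps_before ws x))"
  using assms
proof (induction ws arbitrary: e p y)
  case Nil
  thus ?case by auto
next
  case (Cons w ws)
  show ?case
  proof (cases w)
    case North_East
    have "0 \<le> y + 1" using Cons.prems by simp
    note IH = Cons.IH[OF this, of e North_East]
    show ?thesis
      unfolding North_East using Cons.prems
      by (simp add: IH all_le_Suc_iff All_less_Suc2 height_Cons_Suc east_steps_before_Cons_Suc) auto
  next
    case South_East
    show ?thesis
    proof (cases "y > 0")
      case True
      hence "0 \<le> y - 1" by simp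
      note IH = Cons.IH[OF this, of e South_East]
      show ?thesis
        unfolding South_East using Cons.prems True
        by (simp add: IH all_le_Suc_iff All_less_Suc2 height_Cons_Suc east_steps_before_Cons_Suc)
    next
      case False
      hence "\<not> 0 \<le> height y (South_East # ws) (Suc 0)"
        by (simp add: height_Cons_Suc)
      thus ?thesis
        unfolding South_East using False by (auto intro!: exI[of _ "Suc 0"])
    qed
  next
    case East
    note IH = Cons.IH[of 0 "Suc e" East]
    show ?thesis
      unfolding East using Cons.prems
      by (auto simp: IH all_le_Suc_iff All_less_Suc2 height_Cons_Suc east_steps_before_Cons_Suc)
  qed
qed

lemma accepts_iff_locally_admissible:
  assumes "0 \<le> s"
  shows "accepts k 0 South_East s ws \<longleftrightarrow> lattice_path s ws \<and> locally_admissible s ws k"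
proof -
  have "(South_East # ws) ! x = North_East \<longleftrightarrow> x > 0 \<and> ws ! (x - 1) = North_East" for x
    by (cases x) auto
  moreover have "last (South_East # ws) = South_East \<longleftrightarrow> ws = [] \<or> last ws = South_East"
    by simp
  ultimately show ?thesis
    unfolding accepts_iff[OF assms] lattice_path_def locally_admissible_def add_0_left by blast
qed

section \<open>Peaks, major index and the count \<open>S\<close>\<close>

definition peaks_after :: "step \<Rightarrow> step list \<Rightarrow> nat set" where
  "peaks_after p ws = {x. x < length ws \<and> (p # ws) ! x = North_East \<and> ws ! x = South_East}"

lemma peaks_after_Cons:
  "peaks_after p (w # ws) = (if p = North_East \<and> w = South_East then {0} else {}) \<union> Suc ` peaks_after w ws"
proof (rule set_eqI)
  fix x
  show "x \<in> peaks_after p (w # ws) \<longleftrightarrow>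
      x \<in> (if p = North_East \<and> w = South_East then {0} else {}) \<union> Suc ` peaks_after w ws"
    by (cases x) (auto simp: peaks_after_def)
qed

lemma peaks_eq: "peaks ws = peaks_after South_East ws"
proof (rule set_eqI)
  fix x
  show "x \<in> peaks ws \<longleftrightarrow> x \<in> peaks_after South_East ws"
    by (cases x) (auto simp: peaks_after_def peaks_def)
qed

lemma peaks_after_sums:
  "finite (peaks_after p ws) \<and> card (peaks_after p ws) = npeaks p ws \<and> \<Sum>(peaks_after p ws) = major ws"
proof (induction ws arbitrary: p)
  case Nil
  show ?case by (simp add: peaks_after_def)
next
  case (Cons w ws)
  have "\<Sum>(Suc ` peaks_after w ws) = npeaks w ws + major ws"
    using Cons.IH[of w] by (simp add: sum.reindex sum_Suc)
  moreover have "card (Suc ` peaks_after w ws) = npeaks w ws"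
    using Cons.IH[of w] by (simp add: card_image)
  ultimately show ?case
    using Cons.IH[of w] by (auto simp: peaks_after_Cons)
qed

lemma major_index_eq: "major_index ws = major ws"
  using peaks_after_sums by (simp add: major_index_def peaks_eq)

lemma npeaks_le_major: "npeaks South_East ws \<le> major ws"
  by (cases ws) auto

text \<open>Each peak has weight at least 1, so there are at most \<open>m\<close> of them. The
  parity hypothesis makes the starting height even, as the local description of admissibility
  requires.\<close>

lemma S_paths_eq_words:
  assumes "1 \<le> a" "a \<le> k" "k mod 2 \<noteq> a mod 2"
  shows "S_paths k a m = (\<Union>N\<le>m. words k 0 South_East (int k + 1 - int a) N m)"
proof -
  define s where "s = int k + 1 - int a"
  have s: "0 \<le> s" "s \<le> int k" "even s"
    using assms unfolding s_def by (auto, presburger)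
  have "ws \<in> S_paths k a m \<longleftrightarrow> accepts k 0 South_East s ws \<and> major ws = m" for ws
  proof -
    have "ws \<in> S_paths k a m \<longleftrightarrow> lattice_path s ws \<and> major ws = m \<and> globally_admissible s ws k"
      unfolding S_paths_def Let_def s_def[symmetric] major_index_eq
      by (simp add: globally_admissible_def)
    thus ?thesis
      using accepts_iff_locally_admissible[OF s(1)] globally_iff_locally_admissible s(2,3) by blast
  qed
  thus ?thesis
    unfolding s_def[symmetric] words_def using npeaks_le_major by auto
qed

lemma S_eq_sum_peak_gf:
  assumes "1 \<le> a" "a \<le> k" "k mod 2 \<noteq> a mod 2"
  shows "of_nat (S k a m) = (\<Sum>N\<le>m. fps_nth (peak_gf (k - 2) ((k + 1 - a) div 2) N) m)"
proof -
  define j where "j = (k + 1 - a) div 2"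
  have j: "int k + 1 - int a = 2 * int j" "2 * j \<le> k" "k = k - 2 + 2"
    using assms unfolding j_def by presburger+
  have "S k a m = (\<Sum>N\<le>m. card (words k 0 South_East (2 * int j) N m))"
    unfolding S_def S_paths_eq_words[OF assms] j(1)
  proof (rule card_UN_disjoint)
    show "\<forall>N\<in>{..m}. finite (words k 0 South_East (2 * int j) N m)"
      using j(2) by (auto intro: finite_words)
    show "\<forall>N\<in>{..m}. \<forall>N'\<in>{..m}. N \<noteq> N' \<longrightarrow>
        words k 0 South_East (2 * int j) N m \<inter> words k 0 South_East (2 * int j) N' m = {}"
      by (auto simp: words_def)
  qed simp
  moreover have "of_nat (card (words k 0 South_East (2 * int j) N m)) = fps_nth (peak_gf (k - 2) j N) m" for N
    using word_gf_eq_peak_gf[of 0 j "k - 2" N] j(2,3) by (simp add: word_gf_def fps_eq_iff)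
  ultimately show ?thesis
    by (simp add: j_def)
qed

section \<open>Summation over tuples\<close>

lemma inverse_prod_fps: "inverse (\<Prod>i\<in>A. f i :: 'a::field fps) = (\<Prod>i\<in>A. inverse (f i))"
  by (induction A rule: infinite_finite_induct) (simp_all add: fps_inverse_mult)

lemma fps_prod_nth_0: "fps_nth (\<Prod>i\<in>A. f i :: 'a::comm_ring_1 fps) 0 = (\<Prod>i\<in>A. fps_nth (f i) 0)"
  by (induction A rule: infinite_finite_induct) simp_all

definition doubled :: "nat \<Rightarrow> nat \<Rightarrow> nat \<Rightarrow> nat set" where
  "doubled k a i = {l \<in> {i..k-1}. a \<le> l \<and> even (l - a)}"

text \<open>The part of the summand that involves only the coordinates from \<open>i\<close> on;
  \<open>i = 1\<close> gives the full summand.\<close>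

definition weight :: "nat \<Rightarrow> nat \<Rightarrow> nat \<Rightarrow> (nat \<Rightarrow> nat) \<Rightarrow> rat fps" where
  "weight k a i n = q ^ ((\<Sum>l=i..k-1. (tail_sum k n l)\<^sup>2) + (\<Sum>l\<in>doubled k a i. 2 * tail_sum k n l))
     * (\<Prod>l=i..k-2. inv_qfac (n l))
     * (qpochhammer (- q) (q ^ 2) (n (k - 1)) * inverse (qpochhammer (q ^ 4) (q ^ 4) (n (k - 1))))"

definition tuples :: "nat \<Rightarrow> nat \<Rightarrow> nat \<Rightarrow> (nat \<Rightarrow> nat) set" where
  "tuples k i N = {n \<in> {i..k-1} \<rightarrow>\<^sub>E UNIV. tail_sum k n i = N}"

lemma finite_tuples: "finite (tuples k i N)"
proof (rule finite_subset)
  show "tuples k i N \<subseteq> {i..k-1} \<rightarrow>\<^sub>E {..N}"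
    unfolding tuples_def tail_sum_def by (auto intro!: PiE_I member_le_sum)
qed (simp add: finite_PiE)

lemma tail_sum_fun_upd: "i < l \<Longrightarrow> tail_sum k (n(i := v)) l = tail_sum k n l"
  unfolding tail_sum_def by (rule sum.cong) auto

lemma tail_sum_rec: "i \<le> k - 1 \<Longrightarrow> tail_sum k n i = n i + tail_sum k n (Suc i)"
  unfolding tail_sum_def by (rule sum.atLeast_Suc_atMost)

text \<open>Fibring over the next tail sum \<open>M\<close>: the coordinate at \<open>i\<close> is
  then forced to be \<open>N - M\<close>, which produces the convolution.\<close>

lemma sum_tuples_rec:
  assumes "i < k - 1"
  shows "(\<Sum>n\<in>tuples k i N. f n) = (\<Sum>M\<le>N. \<Sum>n\<in>tuples k (Suc i) M. f (n(i := N - M)))"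
proof -
  have "(\<Sum>M\<le>N. \<Sum>n\<in>tuples k (Suc i) M. f (n(i := N - M)))
      = (\<Sum>(M, n)\<in>(SIGMA M:{..N}. tuples k (Suc i) M). f (n(i := N - M)))"
    by (rule sum.Sigma) (auto simp: finite_tuples)
  also have "\<dots> = (\<Sum>n\<in>tuples k i N. f n)"
  \<comment> \<open>Removing coordinate \<open>i\<close> means resetting it to
    \<open>undefined\<close>, the value of extensional functions outside their domain.\<close>
  proof (rule sum.reindex_bij_witness[where i = "\<lambda>n. (tail_sum k n (Suc i), n(i := undefined))"
        and j = "\<lambda>(M, n). n(i := N - M)"])
    fix Mn assume "Mn \<in> (SIGMA M:{..N}. tuples k (Suc i) M)"
    then obtain M n where Mn: "Mn = (M, n)" "M \<le> N" "n \<in> {Suc i..k-1} \<rightarrow>\<^sub>E UNIV" "tail_sum k n (Suc i) = M"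
      by (auto simp: tuples_def)
    have "n i = undefined" by (rule PiE_arb[OF Mn(3)]) simp
    hence "n(i := undefined) = n" by (simp add: fun_upd_idem)
    thus "(tail_sum k (case Mn of (M, n) \<Rightarrow> n(i := N - M)) (Suc i), (case Mn of (M, n) \<Rightarrow> n(i := N - M))(i := undefined)) = Mn"
      using Mn by (simp add: tail_sum_fun_upd)
    have "n(i := N - M) \<in> {i..k-1} \<rightarrow>\<^sub>E UNIV"
      using Mn(3) assms by (auto simp: PiE_iff extensional_def)
    moreover have "tail_sum k (n(i := N - M)) i = N"
      using Mn assms by (simp add: tail_sum_rec tail_sum_fun_upd)
    ultimately show "(case Mn of (M, n) \<Rightarrow> n(i := N - M)) \<in> tuples k i N"
      using Mn by (simp add: tuples_def)
    show "f (case Mn of (M, n) \<Rightarrow> n(i := N - M)) = (case Mn of (M, n) \<Rightarrow> f (n(i := N - M)))"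
      by (simp add: Mn)
  next
    fix n assume "n \<in> tuples k i N"
    hence n: "n \<in> {i..k-1} \<rightarrow>\<^sub>E UNIV" "n i + tail_sum k n (Suc i) = N"
      using tail_sum_rec[of i k n] assms by (auto simp: tuples_def)
    have "n i = N - tail_sum k n (Suc i)" using n(2) by simp
    thus "(case (tail_sum k n (Suc i), n(i := undefined)) of (M, n) \<Rightarrow> n(i := N - M)) = n"
      by simp (metis fun_upd_triv)
    have "n(i := undefined) \<in> {Suc i..k-1} \<rightarrow>\<^sub>E UNIV"
      using n(1) by (auto simp: PiE_iff extensional_def)
    thus "(tail_sum k n (Suc i), n(i := undefined)) \<in> (SIGMA M:{..N}. tuples k (Suc i) M)"
      using n(2) by (simp add: tuples_def tail_sum_fun_upd)
  qed
  finally show ?thesis ..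
qed

lemma weight_rec:
  assumes "i < k - 1"
  shows "weight k a i (n(i := v)) =
     q ^ ((v + tail_sum k n (Suc i))\<^sup>2 + (if a \<le> i \<and> even (i - a) then 2 * (v + tail_sum k n (Suc i)) else 0))
       * inv_qfac v * weight k a (Suc i) n"
proof -
  let ?n = "n(i := v)"
  have head: "tail_sum k ?n i = v + tail_sum k n (Suc i)"
    using assms by (simp add: tail_sum_rec tail_sum_fun_upd)
  have "(\<Sum>l=i..k-1. (tail_sum k ?n l)\<^sup>2) = (tail_sum k ?n i)\<^sup>2 + (\<Sum>l=Suc i..k-1. (tail_sum k ?n l)\<^sup>2)"
    using assms by (intro sum.atLeast_Suc_atMost) simp
  also have "(\<Sum>l=Suc i..k-1. (tail_sum k ?n l)\<^sup>2) = (\<Sum>l=Suc i..k-1. (tail_sum k n l)\<^sup>2)"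
    by (rule sum.cong) (auto simp: tail_sum_fun_upd)
  finally have sq: "(\<Sum>l=i..k-1. (tail_sum k ?n l)\<^sup>2)
      = (v + tail_sum k n (Suc i))\<^sup>2 + (\<Sum>l=Suc i..k-1. (tail_sum k n l)\<^sup>2)"
    by (simp only: head)
  define b where "b \<longleftrightarrow> a \<le> i \<and> even (i - a)"
  have "doubled k a i = (if b then insert i (doubled k a (Suc i)) else doubled k a (Suc i))"
    using assms by (auto simp: b_def doubled_def Suc_le_eq le_less)
  moreover have "i \<notin> doubled k a (Suc i)" "finite (doubled k a (Suc i))"
    by (auto simp: doubled_def)
  moreover have "(\<Sum>l\<in>doubled k a (Suc i). 2 * tail_sum k ?n l) = (\<Sum>l\<in>doubled k a (Suc i). 2 * tail_sum k n l)"
    by (rule sum.cong) (auto simp: doubled_def tail_sum_fun_upd)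
  ultimately have dbl: "(\<Sum>l\<in>doubled k a i. 2 * tail_sum k ?n l)
      = (if b then 2 * (v + tail_sum k n (Suc i)) else 0)
        + (\<Sum>l\<in>doubled k a (Suc i). 2 * tail_sum k n l)"
    by (simp add: head)
  have "(\<Prod>l=i..k-2. inv_qfac (?n l)) = inv_qfac (?n i) * (\<Prod>l=Suc i..k-2. inv_qfac (?n l))"
    using assms by (intro prod.atLeast_Suc_atMost) simp
  also have "(\<Prod>l=Suc i..k-2. inv_qfac (?n l)) = (\<Prod>l=Suc i..k-2. inv_qfac (n l))"
    by (rule prod.cong) auto
  finally have pr: "(\<Prod>l=i..k-2. inv_qfac (?n l)) = inv_qfac v * (\<Prod>l=Suc i..k-2. inv_qfac (n l))"
    by simp
  have last: "?n (k - 1) = n (k - 1)" using assms by simp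
  show ?thesis
    unfolding weight_def sq dbl pr last b_def[symmetric] by (simp only: power_add ac_simps)
qed

lemma tuples_last: "tuples k (k - 1) N = {\<lambda>l\<in>{k-1}. N}"
  by (auto simp: tuples_def tail_sum_def PiE_iff extensional_def restrict_def fun_eq_iff)

text \<open>Coordinates are adjoined from \<open>k - 1\<close> downward, and after \<open>t\<close>
  of these steps the ceiling is \<open>t + 2\<close>. The minimum is half the starting height,
  capped by that ceiling. It rises exactly when the new index is doubled, where the second branch of
  \<open>peak_gf\<close> supplies the factor \<open>q ^ (2 * N)\<close>.\<close>

theorem sum_weight_eq_peak_gf:
  assumes "a \<le> k - 1" "k mod 2 \<noteq> a mod 2" "t + 2 \<le> k"
  shows "(\<Sum>n\<in>tuples k (k - 1 - t) N. weight k a (k - 1 - t) n)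
    = peak_gf t (min ((k + 1 - a) div 2) ((t + 2) div 2)) N"
  using assms(3)
proof (induction t arbitrary: N)
  case 0
  \<comment> \<open>The parity hypothesis puts the last index \<open>k - 1\<close> among the doubled
    ones, which corresponds to height 2 under ceiling 2.\<close>
  have odd: "even (k - 1 - a)" using assms by presburger
  have dbl: "doubled k a (k - 1) = {k - 1}"
    using odd assms by (auto simp: doubled_def)
  have empty: "{k - 1..k - 2} = {}" using 0 by auto
  have "1 \<le> (k + 1 - a) div 2"
    using odd assms 0 by presburger
  hence m: "min ((k + 1 - a) div 2) ((0 + 2) div 2) = 1"
    by simp
  define n where "n = (\<lambda>l\<in>{k-1}. N)"
  have n: "n (k - 1) = N" "tail_sum k n (k - 1) = N"
    by (simp_all add: n_def tail_sum_def)
  have "weight k a (k - 1) n = peak_gf 0 1 N"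
    unfolding weight_def dbl empty by (simp add: n mult.assoc del: One_nat_def)
  thus ?case
    unfolding m by (simp only: diff_zero tuples_last n_def[symmetric]) simp
next
  case (Suc t)
  define i where "i = k - 1 - Suc t"
  have i: "i < k - 1" "Suc i = k - 1 - t"
    using Suc.prems by (auto simp: i_def)
  define j where "j = min ((k + 1 - a) div 2) ((t + 2) div 2)"
  define j' where "j' = min ((k + 1 - a) div 2) ((Suc t + 2) div 2)"
  define d where "d = (if a \<le> i \<and> even (i - a) then 2 * N else 0)"
  have it: "i + t + 2 = k"
    using Suc.prems by (simp add: i_def)
  have "even (k + 1 - a)"
    using assms by presburger
  then obtain m where m': "k + 1 - a = 2 * m"
    by (elim evenE)
  hence m: "k + 1 = a + 2 * m"
    using assms by linarith
  have j_eq: "j = min m ((t + 2) div 2)" and j'_eq: "j' = min m ((Suc t + 2) div 2)"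
    unfolding j_def j'_def m' by simp_all
  have "(\<Sum>n\<in>tuples k i N. weight k a i n)
     = (\<Sum>M\<le>N. \<Sum>n\<in>tuples k (Suc i) M. weight k a i (n(i := N - M)))"
    by (rule sum_tuples_rec[OF i(1)])
  also have "\<dots> = (\<Sum>M\<le>N. \<Sum>n\<in>tuples k (Suc i) M. q ^ (N\<^sup>2 + d) * (inv_qfac (N - M) * weight k a (Suc i) n))"
    by (intro sum.cong refl) (auto simp: weight_rec[OF i(1)] tuples_def d_def mult.assoc)
  also have "\<dots> = q ^ (N\<^sup>2 + d) * (\<Sum>M\<le>N. inv_qfac (N - M) * (\<Sum>n\<in>tuples k (Suc i) M. weight k a (Suc i) n))"
    by (simp only: sum_distrib_left)
  also have "\<dots> = q ^ (N\<^sup>2 + d) * conv (peak_gf t j) N"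
    using Suc.IH Suc.prems by (simp add: i(2) conv_def j_def)
  also have "\<dots> = peak_gf (Suc t) j' N"
  \<comment> \<open>At a doubled index \<open>t\<close> is odd and the cap is still active, so it
    rises by 1. Otherwise either \<open>t\<close> is even and rounding keeps the cap, or
    \<open>i < a\<close> and the minimum has already settled at \<open>m\<close>.\<close>
  proof (cases "a \<le> i \<and> even (i - a)")
    case True
    have "odd t"
      using True m it by presburger
    then obtain h where h: "t = 2 * h + 1"
      by (elim oddE)
    have "m \<ge> h + 2"
      using True m it h by linarith
    hence "\<not> 2 * j' \<le> t + 2" "j' - 1 = j"
      by (simp_all add: j_eq j'_eq h)
    moreover have "d = 2 * N"
      unfolding d_def using True by (rule if_P)
    ultimately show ?thesis by simp
  next
    case False
    have "2 * j' \<le> t + 2 \<and> j' = j"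
    proof (cases "a \<le> i")
      case True
      hence "even t"
        using False m it by presburger
      then obtain h where h: "t = 2 * h"
        by (elim evenE)
      show ?thesis
        by (simp add: j_eq j'_eq h min_def)
    next
      case False
      hence "m \<le> (t + 2) div 2" "(t + 2) div 2 \<le> (Suc t + 2) div 2"
        using m it by linarith+
      thus ?thesis
        by (auto simp: j_eq j'_eq min_def)
    qed
    moreover have "d = 0"
      unfolding d_def using False by (rule if_not_P)
    ultimately show ?thesis by simp
  qed
  finally show ?case by (simp only: i_def j'_def)
qed

section \<open>Coefficientwise convergence of the infinite sum\<close>

lemma weight_nth_eq_0:
  assumes "1 \<le> k - 1" "m < tail_sum k n 1"
  shows "fps_nth (weight k a 1 n) m = 0"
proof -
  have "tail_sum k n 1 \<le> (tail_sum k n 1)\<^sup>2"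
    by (simp add: power2_eq_square)
  also have "\<dots> \<le> (\<Sum>l=1..k-1. (tail_sum k n l)\<^sup>2)"
    using assms(1) by (intro member_le_sum) auto
  finally show ?thesis
    using assms(2) by (simp add: weight_def mult.assoc fps_X_power_mult_nth)
qed

lemma summand_eq_weight:
  "fps_X ^ ((\<Sum>i=1..k-1. (tail_sum k n i)\<^sup>2)
               + (\<Sum>i\<in>{i\<in>{a..k-1}. even (i - a)}. 2 * tail_sum k n i))
      * qpochhammer (- fps_X) (fps_X ^ 2) (n (k - 1))
      / ((\<Prod>i=1..k-2. qpochhammer (fps_X ^ 2) (fps_X ^ 2) (n i))
         * qpochhammer (fps_X ^ 4) (fps_X ^ 4) (n (k - 1))) = weight k a 1 n"
  if "1 \<le> a"
proof -
  have "fps_nth (\<Prod>i=1..k-2. qpochhammer (q ^ 2) (q ^ 2) (n i)) 0 = (\<Prod>i=1..k-2. 1)"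
    by (subst fps_prod_nth_0) (simp add: qpochhammer_nth_0)
  moreover have "fps_nth (qpochhammer (q ^ 4) (q ^ 4) (n (k - 1))) 0 = 1"
    by (rule qpochhammer_nth_0) simp
  ultimately have *: "fps_nth ((\<Prod>i=1..k-2. qpochhammer (q ^ 2) (q ^ 2) (n i))
       * qpochhammer (q ^ 4) (q ^ 4) (n (k - 1))) 0 \<noteq> 0"
    by (simp only: fps_mult_nth_0 prod.neutral_const)
  have dbl: "{i \<in> {a..k-1}. even (i - a)} = doubled k a 1"
    using that by (auto simp: doubled_def)
  show ?thesis
    unfolding fps_divide_unit[OF *] fps_inverse_mult inverse_prod_fps inv_qfac_def[symmetric] dbl weight_def
    by (simp only: ac_simps)
qed

theorem theorem1p6:
  fixes k a :: nat
  assumes "k \<ge> a" and "a \<ge> 1" and "k mod 2 \<noteq> a mod 2"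
  shows "((\<lambda>n :: nat \<Rightarrow> nat.
      fps_X ^ ((\<Sum>i=1..k-1. (tail_sum k n i)\<^sup>2)
               + (\<Sum>i\<in>{i\<in>{a..k-1}. even (i - a)}. 2 * tail_sum k n i))
      * qpochhammer (- fps_X) (fps_X ^ 2) (n (k - 1))
      / ((\<Prod>i=1..k-2. qpochhammer (fps_X ^ 2) (fps_X ^ 2) (n i))
         * qpochhammer (fps_X ^ 4) (fps_X ^ 4) (n (k - 1))))
    has_sum (Abs_fps (\<lambda>m. of_nat (S k a m)) :: rat fps))
    ({1..k-1} \<rightarrow>\<^sub>E UNIV)"
proof -
  define j where "j = (k + 1 - a) div 2"
  \<comment> \<open>The parities differ, so \<open>a\<close> is strictly below
    \<open>k\<close>.\<close>
  have k: "a \<le> k - 1" "2 \<le> k"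
    using assms by presburger+
  have level: "(\<Sum>n\<in>tuples k 1 N. weight k a 1 n) = peak_gf (k - 2) j N" for N
  proof -
    have "j \<le> k div 2"
      using assms(2) unfolding j_def by (intro div_le_mono) simp
    hence j: "min ((k + 1 - a) div 2) (k div 2) = j"
      unfolding j_def by simp
    have t: "k - 2 + 2 = k" "k - 1 - (k - 2) = 1"
      using k by simp_all
    show ?thesis
      using sum_weight_eq_peak_gf[OF k(1) assms(3), of "k - 2" N] unfolding t j by simp
  qed
  have "((\<lambda>n. weight k a 1 n) has_sum (Abs_fps (\<lambda>m. of_nat (S k a m)))) ({1..k-1} \<rightarrow>\<^sub>E UNIV)"
    unfolding has_sum_def
  proof (rule tendsto_fpsI)
    fix m
    \<comment> \<open>A weight is divisible by \<open>q\<close> to the power of its first tail sum,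
      which is at most its square. Hence coefficient \<open>m\<close> is settled by this finite set
      of tuples, and every larger finite set gives the same value.\<close>
    let ?F = "\<Union>N\<le>m. tuples k 1 N"
    have "fps_nth (\<Sum>n\<in>F. weight k a 1 n) m = of_nat (S k a m)"
      if F: "finite F" "?F \<subseteq> F" "F \<subseteq> {1..k-1} \<rightarrow>\<^sub>E UNIV" for F
    proof -
      have "fps_nth (\<Sum>n\<in>F. weight k a 1 n) m = (\<Sum>n\<in>F. fps_nth (weight k a 1 n) m)"
        by (rule fps_sum_nth)
      also have "\<dots> = (\<Sum>n\<in>?F. fps_nth (weight k a 1 n) m)"
      proof (rule sum.mono_neutral_right[OF F(1,2)], intro ballI)
        fix n assume "n \<in> F - ?F"
        hence "m < tail_sum k n 1"
          using F(3) by (auto simp: tuples_def not_le[symmetric])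
        thus "fps_nth (weight k a 1 n) m = 0"
          using k by (intro weight_nth_eq_0) auto
      qed
      also have "\<dots> = (\<Sum>N\<le>m. \<Sum>n\<in>tuples k 1 N. fps_nth (weight k a 1 n) m)"
        by (intro sum.UNION_disjoint ballI impI finite_tuples) (auto simp: tuples_def)
      also have "\<dots> = (\<Sum>N\<le>m. fps_nth (peak_gf (k - 2) j N) m)"
        by (simp only: level[symmetric] fps_sum_nth)
      also have "\<dots> = of_nat (S k a m)"
        using S_eq_sum_peak_gf[OF assms(2,1,3), of m] by (simp only: j_def)
      finally show ?thesis .
    qed
    thus "eventually (\<lambda>F. fps_nth (\<Sum>n\<in>F. weight k a 1 n) m = fps_nth (Abs_fps (\<lambda>m. of_nat (S k a m))) m)
        (finite_subsets_at_top ({1..k-1} \<rightarrow>\<^sub>E UNIV))"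
      unfolding eventually_finite_subsets_at_top
      by (intro exI[of _ ?F]) (auto simp: finite_tuples, auto simp: tuples_def)
  qed
  thus ?thesis
    by (simp only: summand_eq_weight[OF assms(2)])
qed

end
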